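(* Let $M=(E,\mathcal{I})$ be a matroid with ground set $E=\{1,\dots,n\}$, let $m,\Delta$ be positive integers, and let $W\in\{-\Delta,\dots,\Delta\}^{m\times n}$ be a matrix whose column $W(e)$ is the weight vector of element $e$. Let $A$ be a basis of $M$ and let $x^*$ be any vertex of the polytope \[ \{x\in\mathbb{R}^n : x\in P_B(M),\ Wx=W(A)\}. \] Then there exists a basis $A'$ of $M$ with $W(A')=W(A)$ and \[ \|x^*-\chi(A')\|_1\le (2m\Delta)^{13m}. \]
   Context: For $S\subseteq E$, $\chi(S)\in\{0,1\}^n$ is its characteristic vector and $W(S)=W\chi(S)=\sum_{e\in S}W(e)$. The base polytope $P_B(M)\subseteq[0,1]^n$ is the convex hull of the characteristic vectors $\chi(B)$ of all bases $B$ of $M$. *)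

theory Defs
  imports "HOL-Analysis.Analysis"
begin

text \<open>A matroid on the finite ground set UNIV (of type 'n, playing the role of
  E = {1..n}), given by its independence predicate.\<close>
definition matroid :: "('n::finite set \<Rightarrow> bool) \<Rightarrow> bool" where
  "matroid indep \<longleftrightarrow>
     indep {} \<and>
     (\<forall>I J. indep J \<and> I \<subseteq> J \<longrightarrow> indep I) \<and>
     (\<forall>I J. indep I \<and> indep J \<and> card I < card J \<longrightarrow>
        (\<exists>e\<in>J - I. indep (insert e I)))"

definition is_basis :: "('n::finite set \<Rightarrow> bool) \<Rightarrow> 'n set \<Rightarrow> bool" where
  "is_basis indep B \<longleftrightarrow> indep B \<and> (\<forall>C. indep C \<and> B \<subseteq> C \<longrightarrow> C = B)"

definition charvec :: "'n::finite set \<Rightarrow> real^'n" where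
  "charvec S = (\<chi> e. if e \<in> S then 1 else 0)"

definition base_polytope :: "('n::finite set \<Rightarrow> bool) \<Rightarrow> (real^'n) set" where
  "base_polytope indep = convex hull {charvec B | B. is_basis indep B}"

definition wmult :: "int^'n::finite^'m::finite \<Rightarrow> real^'n \<Rightarrow> real^'m" where
  "wmult W x = (\<chi> i. \<Sum>e\<in>UNIV. real_of_int (W $ i $ e) * x $ e)"

definition wset :: "int^'n::finite^'m::finite \<Rightarrow> 'n set \<Rightarrow> int^'m" where
  "wset W S = (\<chi> i. \<Sum>e\<in>S. W $ i $ e)"

definition l1dist :: "real^'n::finite \<Rightarrow> real^'n \<Rightarrow> real" where
  "l1dist x y = (\<Sum>e\<in>UNIV. \<bar>x $ e - y $ e\<bar>)"

end

theory Submission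
  imports Defs
begin

text \<open>
  A representation of \<open>x*\<close> as a convex combination of bases with maximal support is closed under
  symmetric exchange. A path of exchanges between two bases of the support has directions with
  disjoint supports, and extremality makes \<open>W\<close> injective on their span; so these bases pairwise
  differ in at most \<open>m\<close> elements, and \<open>x*\<close> is within \<open>2m\<close> of one of them, say \<open>B\<close>.

  Let \<open>A\<close> be a basis of the prescribed weight closest to \<open>B\<close>, and group the elements by weight and
  membership in \<open>B\<close>. Call a pair \<open>a \<in> A - B\<close>, \<open>b \<in> B - A\<close> robust if every union of classes that
  contains \<open>b\<close> but not \<open>a\<close> has slack \<open>r(S) - |A \<inter> S| \<ge> N\<close>. By Rado's theorem any \<open>N\<close> disjoint
  robust pairs can be exchanged simultaneously, up to replacing elements within their classes.
  Submodularity of the slack and the deficiency version of Hall's theorem match all but boundedly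
  many elements of \<open>A - B\<close> in robust pairs. The weights of these pairs are bounded and have a
  bounded sum, so if there are many of them, Steinitz's rearrangement argument and the pigeonhole
  principle give at most \<open>N\<close> pairs of total weight zero. Exchanging them would bring \<open>A\<close> closer
  to \<open>B\<close>.
\<close>

section \<open>Zero-sum subfamilies of integer vectors\<close>

text \<open>Working with a family lets a repeated vector count as a dependence, with coefficients 1
  and -1. If all vectors are distinct, their set is too large to be independent.\<close>

lemma family_dependence:
  fixes u :: "'i \<Rightarrow> 'a::euclidean_space"
  assumes "finite F" "DIM('a) < card F"
  shows "\<exists>c. (\<exists>i\<in>F. c i \<noteq> 0) \<and> (\<Sum>i\<in>F. c i *\<^sub>R u i) = 0"
proof (cases "inj_on u F")
  case True
  then have "card (u ` F) > DIM('a)" using assms card_image by metis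
  then have "dependent (u ` F)" using assms dependent_biggerset by blast
  then obtain q where q: "\<exists>v\<in>u ` F. q v \<noteq> 0" "(\<Sum>v\<in>u ` F. q v *\<^sub>R v) = 0"
    using dependent_finite[of "u ` F"] assms by auto
  from q(2) have "(\<Sum>i\<in>F. q (u i) *\<^sub>R u i) = 0"
    using True by (simp add: sum.reindex)
  then show ?thesis using q(1) by (intro exI[of _ "\<lambda>i. q (u i)"]) auto
next
  case False
  then obtain a b where ab: "a \<in> F" "b \<in> F" "a \<noteq> b" "u a = u b"
    by (auto simp: inj_on_def)
  define c :: "'i \<Rightarrow> real" where "c i = (if i = a then 1 else 0) - (if i = b then 1 else 0)" for i
  have "(\<Sum>i\<in>F. c i *\<^sub>R u i) = (\<Sum>i\<in>F. if i = a then u i else 0) - (\<Sum>i\<in>F. if i = b then u i else 0)"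
    unfolding sum_subtractf[symmetric] by (rule sum.cong) (auto simp: c_def)
  also have "\<dots> = 0" using ab assms by simp
  finally have "(\<Sum>i\<in>F. c i *\<^sub>R u i) = 0" .
  moreover have "c a \<noteq> 0" using ab by (simp add: c_def)
  ultimately show ?thesis using ab by blast
qed

text \<open>Move along a linear dependence of the fractional positions until one of them becomes integral.\<close>
lemma few_fractional:
  fixes u :: "'i \<Rightarrow> 'a::euclidean_space" and l :: "'i \<Rightarrow> real"
  assumes "finite X" "\<forall>i\<in>X. 0 \<le> l i \<and> l i \<le> 1"
  shows "\<exists>l'. (\<forall>i\<in>X. 0 \<le> l' i \<and> l' i \<le> 1) \<and> (\<Sum>i\<in>X. l' i *\<^sub>R u i) = (\<Sum>i\<in>X. l i *\<^sub>R u i)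
    \<and> card {i\<in>X. 0 < l' i \<and> l' i < 1} \<le> DIM('a)"
  using assms(2)
proof (induction "card {i\<in>X. 0 < l i \<and> l i < 1}" arbitrary: l rule: less_induct)
  case less
  define F where "F = {i\<in>X. 0 < l i \<and> l i < 1}"
  have finF: "finite F" using assms by (simp add: F_def)
  show ?case
  proof (cases "card F \<le> DIM('a)")
    case True
    then show ?thesis using less.prems by (intro exI[of _ l]) (auto simp: F_def)
  next
    case False
    then obtain c where c: "\<exists>i\<in>F. c i \<noteq> 0" "(\<Sum>i\<in>F. c i *\<^sub>R u i) = 0"
      using family_dependence[OF finF, of u] by auto
    define F' where "F' = {i\<in>F. c i \<noteq> 0}"
    \<comment> \<open>\<open>\<rho> i\<close> is the step length at which position \<open>i\<close>
      reaches 1 (if \<open>c i > 0\<close>) or 0 (if \<open>c i < 0\<close>). The least of these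
      keeps every position in [0,1] and makes its own position integral.\<close>
    define \<rho> where "\<rho> i = (if c i > 0 then (1 - l i) / c i else l i / (- c i))" for i
    define t where "t = Min (\<rho> ` F')"
    have F': "finite F'" "F' \<noteq> {}" using finF c by (auto simp: F'_def)
    have \<rho>pos: "\<rho> i > 0" if "i \<in> F'" for i
      using that by (auto simp: F'_def F_def \<rho>_def divide_pos_neg)
    have "t \<in> \<rho> ` F'" unfolding t_def using F' by (intro Min_in) auto
    then obtain k where k: "k \<in> F'" "t = \<rho> k" by auto
    have t: "t > 0" using k \<rho>pos by auto
    have tle: "t \<le> \<rho> i" if "i \<in> F'" for i unfolding t_def using F' that by simp
    define l' where "l' i = (if i \<in> F then l i + t * c i else l i)" for i
    have b: "0 \<le> l' i \<and> l' i \<le> 1" if i: "i \<in> X" for i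
    proof (cases "i \<in> F'")
      case True
      then have "i \<in> F" by (simp add: F'_def)
      then have li: "0 < l i" "l i < 1" by (auto simp: F_def)
      consider "c i > 0" | "c i < 0" using True by (force simp: F'_def)
      then show ?thesis
      proof cases
        case 1
        then have "t * c i \<le> 1 - l i" "t * c i \<ge> 0"
          using tle[OF True] t by (auto simp: \<rho>_def field_simps)
        then show ?thesis using li \<open>i \<in> F\<close> by (simp add: l'_def)
      next
        case 2
        then have "t * (- c i) \<le> l i" "t * c i \<le> 0"
          using tle[OF True] t by (auto simp: \<rho>_def field_simps mult_le_0_iff)
        then show ?thesis using li \<open>i \<in> F\<close> by (simp add: l'_def)
      qed
    next
      case False
      then have "l' i = l i" by (auto simp: l'_def F'_def)
      then show ?thesis using less.prems i by simp
    qed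
    have "l' k = 0 \<or> l' k = 1"
      using k by (auto simp: l'_def F'_def \<rho>_def)
    then have "{i\<in>X. 0 < l' i \<and> l' i < 1} \<subseteq> F - {k}"
      by (auto simp: l'_def F_def split: if_splits)
    moreover have "k \<in> F" using k by (simp add: F'_def)
    ultimately have less_F: "card {i\<in>X. 0 < l' i \<and> l' i < 1} < card F"
      using finF by (meson card_Diff1_less card_mono finite_Diff order_le_less_trans)
    have eq: "(\<Sum>i\<in>X. l' i *\<^sub>R u i) = (\<Sum>i\<in>X. l i *\<^sub>R u i)"
    proof -
      have "(\<Sum>i\<in>X. l' i *\<^sub>R u i) = (\<Sum>i\<in>X. l i *\<^sub>R u i + (if i \<in> F then t *\<^sub>R (c i *\<^sub>R u i) else 0))"
        by (rule sum.cong) (auto simp: l'_def algebra_simps)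
      also have "\<dots> = (\<Sum>i\<in>X. l i *\<^sub>R u i) + (\<Sum>i\<in>F. t *\<^sub>R (c i *\<^sub>R u i))"
        using assms(1) by (simp add: sum.distrib sum.If_cases F_def Int_def)
      also have "(\<Sum>i\<in>F. t *\<^sub>R (c i *\<^sub>R u i)) = 0"
        using c(2) by (simp only: scaleR_right.sum[symmetric]) simp
      finally show ?thesis by simp
    qed
    show ?thesis
      using less.hyps[OF less_F[unfolded F_def]] b unfolding eq by blast
  qed
qed

text \<open>Scale the weights down to total \<open>card X - 1 - m\<close>. With at most \<open>m + 1\<close> fractional entries,
  this total is too small for all entries to be positive.\<close>
lemma steinitz_step:
  fixes g :: "'i \<Rightarrow> real^'m" and s :: "real^'m"
  assumes X: "finite X" "CARD('m) < card X"
    and l: "\<forall>i\<in>X. 0 \<le> l i \<and> l i \<le> 1"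
    and sl: "sum l X = real (card X) - real CARD('m)"
    and gl: "(\<Sum>i\<in>X. l i *\<^sub>R g i) = (real (card X) - real CARD('m)) *\<^sub>R s"
  shows "\<exists>k\<in>X. \<exists>l'. (\<forall>i\<in>X - {k}. 0 \<le> l' i \<and> l' i \<le> (1::real)) \<and>
    sum l' (X - {k}) = real (card (X - {k})) - real CARD('m) \<and>
    (\<Sum>i\<in>X - {k}. l' i *\<^sub>R g i) = (real (card (X - {k})) - real CARD('m)) *\<^sub>R s"
proof -
  define m where "m = real CARD('m)"
  define K where "K = real (card X)"
  have Km: "K - m \<ge> 1" using X by (simp add: K_def m_def)
  define q where "q = (K - 1 - m) / (K - m)"
  have q: "0 \<le> q" "q \<le> 1" "q * (K - m) = K - 1 - m" using Km by (auto simp: q_def)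
  \<comment> \<open>The constant coordinate 1 makes the total of the coefficients part of the
    preserved sum. It costs one dimension, hence up to \<open>m + 1\<close> fractional
    entries.\<close>
  define u where "u i = (g i, 1::real)" for i
  have "\<forall>i\<in>X. 0 \<le> q * l i \<and> q * l i \<le> 1"
    using l q by (auto intro: mult_le_one)
  from few_fractional[OF X(1) this, of u] obtain l' where
    l': "\<forall>i\<in>X. 0 \<le> l' i \<and> l' i \<le> 1"
    and eq: "(\<Sum>i\<in>X. l' i *\<^sub>R u i) = (\<Sum>i\<in>X. (q * l i) *\<^sub>R u i)"
    and fr: "card {i\<in>X. 0 < l' i \<and> l' i < 1} \<le> DIM((real^'m) \<times> real)" by blast
  have fr': "card {i\<in>X. 0 < l' i \<and> l' i < 1} \<le> CARD('m) + 1" using fr by simp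
  have "sum l' X = (\<Sum>i\<in>X. q * l i)"
    using arg_cong[OF eq, of snd] by (simp add: u_def snd_sum)
  then have s1: "sum l' X = K - 1 - m"
    using sl q by (simp add: sum_distrib_left[symmetric] K_def m_def)
  have "(\<Sum>i\<in>X. l' i *\<^sub>R g i) = q *\<^sub>R (\<Sum>i\<in>X. l i *\<^sub>R g i)"
    using arg_cong[OF eq, of fst] by (simp add: u_def fst_sum scaleR_sum_right)
  also have "\<dots> = q *\<^sub>R ((K - m) *\<^sub>R s)"
    using gl by (simp add: K_def m_def)
  also have "\<dots> = (K - 1 - m) *\<^sub>R s" using q by simp
  finally have g1: "(\<Sum>i\<in>X. l' i *\<^sub>R g i) = (K - 1 - m) *\<^sub>R s" .
  \<comment> \<open>If all entries were positive, those outside \<open>F\<close> would equal 1. The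
    total would then be \<open>K\<close> if \<open>F\<close> is empty, and otherwise strictly more
    than \<open>K - card F\<close>, which is at least \<open>K - 1 - m\<close>; both contradict
    \<open>s1\<close>.\<close>
  have "\<exists>k\<in>X. l' k = 0"
  proof (rule ccontr)
    assume "\<not> ?thesis"
    then have pos: "l' i > 0" if "i \<in> X" for i using l' that by force
    define F where "F = {i\<in>X. 0 < l' i \<and> l' i < 1}"
    have F: "F \<subseteq> X" "finite F" using X by (auto simp: F_def)
    have "sum l' (X - F) = (\<Sum>i\<in>X - F. 1)"
      using pos l' by (intro sum.cong) (force simp: F_def)+
    then have e: "sum l' X = real (card (X - F)) + sum l' F"
      using F X by (simp add: sum.subset_diff)
    have c: "real (card (X - F)) = K - real (card F)"
      using F X by (simp add: card_Diff_subset K_def card_mono of_nat_diff)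
    show False
    proof (cases "F = {}")
      case True then show False using e c s1 by (simp add: m_def)
    next
      case False
      then have "sum l' F > 0" using F pos by (intro sum_pos) auto
      moreover have "real (card F) \<le> m + 1" using fr' by (simp add: F_def m_def)
      ultimately show False using e c s1 by linarith
    qed
  qed
  then obtain k where k: "k \<in> X" "l' k = 0" by blast
  have c: "real (card (X - {k})) = K - 1" using k X by (simp add: K_def)
  have "sum l' (X - {k}) = sum l' X" "(\<Sum>i\<in>X - {k}. l' i *\<^sub>R g i) = (\<Sum>i\<in>X. l' i *\<^sub>R g i)"
    using k X by (simp_all add: sum_diff1)
  then show ?thesis using k l' c s1 g1 by (intro bexI[of _ k] exI[of _ l']) (auto simp: m_def)
qed

text \<open>Iterating \<open>steinitz_step\<close> deletes indices one by one while keeping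
  coefficients in [0,1] of total \<open>card (X n) - m\<close> whose weighted sum is exactly the
  proportional share of the full sum. The plain sum over \<open>X n\<close> differs from that share
  by a combination with coefficients \<open>1 - l i\<close>, which are nonnegative and total
  \<open>m\<close>; hence the error \<open>m * D\<close>.\<close>

lemma steinitz_chain:
  fixes g :: "'i \<Rightarrow> real^'m"
  assumes I: "finite I" "CARD('m) \<le> card I" "I \<noteq> {}"
    and b: "\<forall>i\<in>I. \<forall>j. \<bar>g i $ j\<bar> \<le> D"
  shows "\<exists>X. \<forall>n \<le> card I - CARD('m). X n \<subseteq> I \<and> card (X n) = card I - n \<and>
      (n < card I - CARD('m) \<longrightarrow> X (Suc n) \<subseteq> X n) \<and>
      (\<forall>j. \<bar>sum g (X n) $ j - (real (card I) - real n - real CARD('m)) / real (card I) * sum g I $ j\<bar>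
         \<le> real CARD('m) * D)"
proof -
  define R where "R = card I"
  define M where "M = CARD('m)"
  define s where "s = (1 / real R) *\<^sub>R sum g I"
  have R: "R > 0" using I by (auto simp: R_def card_gt_0_iff)
  define \<Phi> where "\<Phi> X \<longleftrightarrow> (\<exists>l. (\<forall>i\<in>X. 0 \<le> l i \<and> l i \<le> (1::real)) \<and>
      sum l X = real (card X) - real M \<and>
      (\<Sum>i\<in>X. l i *\<^sub>R g i) = (real (card X) - real M) *\<^sub>R s)" for X
  have "\<Phi> I"
  proof -
    have "M \<le> R" using I by (simp add: R_def M_def)
    then show ?thesis unfolding \<Phi>_def
      using R by (intro exI[of _ "\<lambda>_. (real R - real M) / real R"])
        (auto simp: s_def R_def scaleR_right.sum[symmetric])
  qed
  have "\<exists>X. \<forall>n. (n \<le> R - M \<longrightarrow> X n \<subseteq> I \<and> card (X n) = R - n \<and> \<Phi> (X n)) \<and>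
      (n < R - M \<longrightarrow> X (Suc n) \<subseteq> X n)"
  proof (rule dependent_nat_choice)
    show "\<exists>x. 0 \<le> R - M \<longrightarrow> x \<subseteq> I \<and> card x = R - 0 \<and> \<Phi> x"
      using \<open>\<Phi> I\<close> by (auto simp: R_def)
  next
    fix X n assume A: "n \<le> R - M \<longrightarrow> X \<subseteq> I \<and> card X = R - n \<and> \<Phi> X"
    show "\<exists>y. (Suc n \<le> R - M \<longrightarrow> y \<subseteq> I \<and> card y = R - Suc n \<and> \<Phi> y) \<and> (n < R - M \<longrightarrow> y \<subseteq> X)"
    proof (cases "n < R - M")
      case True
      then have X: "X \<subseteq> I" "card X = R - n" "\<Phi> X" using A by auto
      have fX: "finite X" using X I finite_subset by blast
      have cX: "CARD('m) < card X" using True X by (simp add: M_def)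
      obtain l where l: "\<forall>i\<in>X. 0 \<le> l i \<and> l i \<le> (1::real)"
        "sum l X = real (card X) - real CARD('m)"
        "(\<Sum>i\<in>X. l i *\<^sub>R g i) = (real (card X) - real CARD('m)) *\<^sub>R s"
        using X(3) by (auto simp: \<Phi>_def M_def)
      obtain k where k: "k \<in> X" "\<Phi> (X - {k})"
        using steinitz_step[OF fX cX l] unfolding \<Phi>_def M_def by (rule bexE)
      then show ?thesis using X fX by (intro exI[of _ "X - {k}"]) auto
    qed auto
  qed
  then obtain X where X0: "\<forall>n. (n \<le> R - M \<longrightarrow> X n \<subseteq> I \<and> card (X n) = R - n \<and> \<Phi> (X n)) \<and>
      (n < R - M \<longrightarrow> X (Suc n) \<subseteq> X n)" by (rule exE)
  have X: "n \<le> R - M \<Longrightarrow> X n \<subseteq> I \<and> card (X n) = R - n \<and> \<Phi> (X n)"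
    "n < R - M \<Longrightarrow> X (Suc n) \<subseteq> X n" for n using X0 by simp_all
  have "\<bar>sum g (X n) $ j - (real R - real n - real M) / real R * sum g I $ j\<bar> \<le> real M * D"
    if n: "n \<le> R - M" for n j
  proof -
    obtain l where l: "\<forall>i\<in>X n. 0 \<le> l i \<and> l i \<le> (1::real)"
        "sum l (X n) = real (card (X n)) - real M"
        "(\<Sum>i\<in>X n. l i *\<^sub>R g i) = (real (card (X n)) - real M) *\<^sub>R s"
      using X(1)[OF n] by (auto simp: \<Phi>_def)
    have fX: "X n \<subseteq> I" "finite (X n)" using X(1)[OF n] I finite_subset by auto
    have c: "real (card (X n)) = real R - real n" using X(1)[OF n] n by auto
    have "(real R - real n - real M) / real R * sum g I $ j = (\<Sum>i\<in>X n. l i *\<^sub>R g i) $ j"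
      using l(3) c by (simp add: s_def)
    then have "\<bar>sum g (X n) $ j - (real R - real n - real M) / real R * sum g I $ j\<bar>
        = \<bar>\<Sum>i\<in>X n. (1 - l i) * g i $ j\<bar>"
      by (simp add: sum_subtractf algebra_simps)
    also have "\<dots> \<le> (\<Sum>i\<in>X n. (1 - l i) * D)"
      by (rule order.trans[OF sum_abs], rule sum_mono)
        (use l(1) b fX in \<open>auto simp: abs_mult intro!: mult_mono\<close>)
    also have "\<dots> = (real (card (X n)) - sum l (X n)) * D"
      by (simp add: sum_distrib_right[symmetric] sum_subtractf)
    also have "\<dots> = real M * D" using l(2) by simp
    finally show ?thesis .
  qed
  then show ?thesis using X unfolding R_def M_def by (intro exI[of _ X]) auto
qed

section \<open>Pigeonhole on partial sums in an integer box\<close>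

lemma card_vec_box:
  fixes S :: "'m::finite \<Rightarrow> 'a set"
  assumes "\<And>i. finite (S i)"
  shows "finite {v::'a^'m. \<forall>i. v $ i \<in> S i}"
    and "card {v::'a^'m. \<forall>i. v $ i \<in> S i} = (\<Prod>i\<in>UNIV. card (S i))"
proof -
  have b: "bij_betw vec_nth {v::'a^'m. \<forall>i. v $ i \<in> S i} (PiE UNIV S)"
    by (rule bij_betw_byWitness[of _ vec_lambda]) auto
  show "finite {v::'a^'m. \<forall>i. v $ i \<in> S i}"
    using bij_betw_finite[OF b] assms by (simp add: finite_PiE)
  show "card {v::'a^'m. \<forall>i. v $ i \<in> S i} = (\<Prod>i\<in>UNIV. card (S i))"
    using bij_betw_same_card[OF b] by (simp add: card_PiE)
qed

text \<open>Over the first \<open>N\<close> steps of the Steinitz chain the proportional share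
  drifts by at most 1 in each coordinate, because \<open>N * K \<le> card I\<close>. So
  \<open>N + 1\<close> partial sums lie in a box with only \<open>N\<close> integer points; two of
  them coincide, and the indices deleted in between sum to zero.\<close>

lemma zero_sum_subset:
  fixes g :: "'i \<Rightarrow> int^'m" and D K N :: nat
  assumes I: "finite I"
    and b: "\<forall>i\<in>I. \<forall>j. \<bar>g i $ j\<bar> \<le> int D"
    and K: "\<forall>j. \<bar>sum g I $ j\<bar> \<le> int K"
    and N: "N = (2 * CARD('m) * D + 2) ^ CARD('m)"
    and R: "N * K \<le> card I" "N + CARD('m) \<le> card I"
  shows "\<exists>Z\<subseteq>I. Z \<noteq> {} \<and> card Z \<le> N \<and> sum g Z = 0"
proof -
  define M where "M = CARD('m)"
  define g' :: "'i \<Rightarrow> real^'m" where "g' i = (\<chi> j. real_of_int (g i $ j))" for i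
  have sg': "sum g' X $ j = real_of_int (sum g X $ j)" for X j by (simp add: g'_def)
  have M: "M > 0" by (simp add: M_def)
  have Rpos: "real (card I) > 0" using R M unfolding M_def by linarith
  have I2: "CARD('m) \<le> card I" "I \<noteq> {}" using R Rpos by auto
  have "\<forall>i\<in>I. \<forall>j. \<bar>g' i $ j\<bar> \<le> real D"
    using b by (simp add: g'_def) (metis of_int_abs of_int_le_iff of_int_of_nat_eq)
  from steinitz_chain[OF I I2 this] obtain X where
    X0: "\<forall>n \<le> card I - M. X n \<subseteq> I \<and> card (X n) = card I - n \<and>
      (n < card I - M \<longrightarrow> X (Suc n) \<subseteq> X n) \<and>
      (\<forall>j. \<bar>sum g' (X n) $ j - (real (card I) - real n - real M) / real (card I) * sum g' I $ j\<bar>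
         \<le> real M * real D)"
    unfolding M_def by (rule exE)
  have X: "n \<le> card I - M \<Longrightarrow> X n \<subseteq> I \<and> card (X n) = card I - n"
      "n < card I - M \<Longrightarrow> X (Suc n) \<subseteq> X n"
    and Xb: "n \<le> card I - M \<Longrightarrow>
      \<bar>sum g' (X n) $ j - (real (card I) - real n - real M) / real (card I) * sum g' I $ j\<bar>
         \<le> real M * real D" for n j
    using X0 by simp_all
  have NR: "N \<le> card I - M" using R by (simp add: M_def)
  define s where "s n = sum g (X n)" for n
  define c where "c n j = (real (card I) - real n - real M) / real (card I) * sum g' I $ j" for n j
  define lo where "lo j = \<lceil>min (c 0 j) (c N j) - real M * real D\<rceil>" for j
  have step: "c n j = c 0 j - real n * (sum g' I $ j / real (card I))" for n j
    using Rpos by (simp add: c_def field_simps)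
  have small: "\<bar>real N * (sum g' I $ j / real (card I))\<bar> \<le> 1" for j
  proof -
    have "\<bar>sum g' I $ j\<bar> \<le> real K"
      unfolding sg' using K by (metis of_int_abs of_int_le_iff of_int_of_nat_eq)
    then have "real N * \<bar>sum g' I $ j\<bar> \<le> real N * real K" by (simp add: mult_left_mono)
    also have "\<dots> \<le> real (card I)" using R(1) by (simp only: of_nat_le_iff flip: of_nat_mult)
    finally show ?thesis using Rpos by (simp add: abs_mult field_simps)
  qed
  \<comment> \<open>An error of \<open>M * D\<close> on either side plus a drift of at most 1 gives
    width \<open>2 * M * D + 1\<close>, that is \<open>2 * M * D + 2\<close> integers per
    coordinate. This is where the base of the power \<open>N\<close> comes from.\<close>
  have box: "s n $ j \<in> {lo j..lo j + int (2 * M * D + 1)}" if n: "n \<le> N" for n j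
  proof -
    define y where "y = sum g' I $ j / real (card I)"
    have cs: "c n j = c 0 j - real n * y" "c N j = c 0 j - real N * y" unfolding y_def by (rule step)+
    have y: "\<bar>real N * y\<bar> \<le> 1" using small by (simp add: y_def)
    \<comment> \<open>\<open>c n j\<close> is affine in \<open>n\<close>, so it stays between its
      values at 0 and \<open>N\<close>, which differ by at most 1.\<close>
    have *: "min (c 0 j) (c N j) \<le> c n j \<and> c n j \<le> min (c 0 j) (c N j) + 1"
    proof (cases "y \<ge> 0")
      case True
      then have "0 \<le> real n * y" "real n * y \<le> real N * y" using n by (auto intro: mult_right_mono)
      then show ?thesis using cs y by auto
    next
      case False
      then have "real n * y \<le> 0" "real N * y \<le> real n * y"
        using n by (auto simp: mult_nonneg_nonpos intro!: mult_right_mono_neg)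
      then show ?thesis using cs y by auto
    qed
    have "\<bar>real_of_int (s n $ j) - c n j\<bar> \<le> real M * real D"
      using Xb[of n j] n NR unfolding s_def sg'[symmetric] c_def by simp
    then have "min (c 0 j) (c N j) - real M * real D \<le> real_of_int (s n $ j)"
      "real_of_int (s n $ j) \<le> min (c 0 j) (c N j) - real M * real D + (2 * real M * real D + 1)"
      using * by linarith+
    moreover have "min (c 0 j) (c N j) - real M * real D \<le> real_of_int (lo j)" by (simp add: lo_def)
    moreover have "real_of_int (lo j + int (2 * M * D + 1)) = real_of_int (lo j) + (2 * real M * real D + 1)"
      by simp
    ultimately have "lo j \<le> s n $ j" "real_of_int (s n $ j) \<le> real_of_int (lo j + int (2 * M * D + 1))"
      unfolding lo_def by (simp add: ceiling_le_iff, linarith)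
    then show ?thesis by (simp only: of_int_le_iff atLeastAtMost_iff simp_thms)
  qed
  define T where "T = {v::int^'m. \<forall>j. v $ j \<in> {lo j..lo j + int (2 * M * D + 1)}}"
  have T: "finite T" "card T = N"
    using card_vec_box[of "\<lambda>j::'m. {lo j..lo j + int (2 * M * D + 1)}"]
    by (simp_all add: T_def N M_def nat_add_distrib nat_mult_distrib)
  have "\<not> inj_on s {0..N}"
  proof
    assume "inj_on s {0..N}"
    moreover have "s ` {0..N} \<subseteq> T" using box by (auto simp: T_def)
    ultimately have "card {0..N} \<le> card T" using T card_inj_on_le by blast
    then show False using T by simp
  qed
  then obtain a d where ad: "a < d" "d \<le> N" "s a = s d"
    unfolding inj_on_def by (metis atLeastAtMost_iff linorder_neqE_nat)
  have sub: "X d \<subseteq> X a"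
  proof -
    have "X e \<subseteq> X a" if "a \<le> e" "e \<le> N" for e
      using that
    proof (induction e rule: dec_induct)
      case (step n)
      have "X (Suc n) \<subseteq> X n" by (rule X(2)) (use step NR in linarith)
      then show ?case using step by simp
    qed simp
    then show ?thesis using ad by simp
  qed
  have fin: "finite (X a)" using X(1)[of a] ad NR I finite_subset by (meson le_trans less_imp_le)
  have cards: "card (X a - X d) = d - a"
    using sub fin X(1)[of a] X(1)[of d] ad NR by (simp add: card_Diff_subset finite_subset)
  show ?thesis
  proof (intro exI conjI)
    show "X a - X d \<subseteq> I" using X(1)[of a] ad NR by force
    show "X a - X d \<noteq> {}" using cards ad by (metis card.empty zero_less_diff less_irrefl)
    show "card (X a - X d) \<le> N" using cards ad by simp
    show "sum g (X a - X d) = 0" using ad(3) sub fin by (simp add: s_def sum_diff finite_subset)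
  qed
qed

section \<open>Matroid exchanges\<close>

text \<open>The chosen parts may be empty, so that this form of Rado's theorem also covers the
  deficiency version of Hall's theorem, where \<open>f S = card S + h\<close>.\<close>
lemma rado:
  fixes f :: "'e::finite set \<Rightarrow> nat" and X :: "'i \<Rightarrow> 'e set"
  assumes fin: "finite J"
    and mono: "\<And>S T. S \<subseteq> T \<Longrightarrow> f S \<le> f T"
    and subm: "\<And>S T. f (S \<union> T) + f (S \<inter> T) \<le> f S + f T"
    and "\<And>J'. J' \<subseteq> J \<Longrightarrow> card J' \<le> f (\<Union>(X ` J'))"
  shows "\<exists>Y. (\<forall>i\<in>J. Y i \<subseteq> X i \<and> card (Y i) \<le> 1) \<and> (\<forall>J'\<subseteq>J. card J' \<le> f (\<Union>(Y ` J')))"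
  using assms(4)
proof (induction "\<Sum>i\<in>J. card (X i)" arbitrary: X rule: less_induct)
  case less
  show ?case
  proof (cases "\<forall>i\<in>J. card (X i) \<le> 1")
    case True
    then show ?thesis using less.prems by (intro exI[of _ X]) auto
  next
    case False
    then obtain k where k: "k \<in> J" "card (X k) \<ge> 2" by force
    then have "\<exists>x y. x \<in> X k \<and> y \<in> X k \<and> x \<noteq> y"
      by (metis card_le_Suc0_iff_eq finite not_less_eq_eq numeral_2_eq_2)
    then obtain x y where xy: "x \<in> X k" "y \<in> X k" "x \<noteq> y" by blast
    define X' where "X' z = X(k := X k - {z})" for z
    \<comment> \<open>One of the two elements can be deleted from \<open>X k\<close>. Otherwise each
      deletion has a violating subfamily, which must contain \<open>k\<close>; let \<open>H\<close>
      and \<open>G\<close> be these subfamilies without \<open>k\<close>. Then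
      \<open>S \<union> T\<close> recovers all of \<open>X k\<close> and \<open>S \<inter> T\<close>
      contains the union over \<open>H \<inter> G\<close>, so the hypothesis on these two families
      contradicts submodularity by one unit.\<close>
    have "\<exists>z\<in>{x, y}. \<forall>J'\<subseteq>J. card J' \<le> f (\<Union>(X' z ` J'))"
    proof (rule ccontr)
      assume neg: "\<not> ?thesis"
      have viol: "\<exists>H\<subseteq>J - {k}. f ((X k - {z}) \<union> \<Union>(X ` H)) \<le> card H" if "z \<in> {x, y}" for z
      proof -
        obtain J' where J': "J' \<subseteq> J" "f (\<Union>(X' z ` J')) < card J'"
          using neg \<open>z \<in> {x, y}\<close> by (metis not_le)
        have "k \<in> J'"
        proof (rule ccontr)
          assume "k \<notin> J'"
          then have "X' z ` J' = X ` J'" by (auto simp: X'_def)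
          then show False using less.prems[OF J'(1)] J'(2) by simp
        qed
        have "\<Union>(X' z ` J') = (X k - {z}) \<union> \<Union>(X ` (J' - {k}))"
          using \<open>k \<in> J'\<close> by (auto simp: X'_def split: if_splits)
        moreover have "card J' = Suc (card (J' - {k}))"
          using \<open>k \<in> J'\<close> J'(1) fin by (metis card.remove finite_subset)
        ultimately show ?thesis using J' by (intro exI[of _ "J' - {k}"]) auto
      qed
      obtain H where H: "H \<subseteq> J - {k}" "f ((X k - {x}) \<union> \<Union>(X ` H)) \<le> card H" using viol by blast
      obtain G where G: "G \<subseteq> J - {k}" "f ((X k - {y}) \<union> \<Union>(X ` G)) \<le> card G" using viol by blast
      have fHG: "finite H" "finite G" using H G fin by (meson finite_Diff finite_subset)+
      define S where "S = (X k - {x}) \<union> \<Union>(X ` H)"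
      define T where "T = (X k - {y}) \<union> \<Union>(X ` G)"
      have "card (insert k (H \<union> G)) \<le> f (\<Union>(X ` insert k (H \<union> G)))"
        using H G k by (intro less.prems) auto
      moreover have "card (insert k (H \<union> G)) = Suc (card (H \<union> G))"
        using H G fHG by (subst card_insert_disjoint) auto
      moreover have "f (\<Union>(X ` insert k (H \<union> G))) \<le> f (S \<union> T)"
        using xy by (intro mono) (auto simp: S_def T_def)
      moreover have "card (H \<inter> G) \<le> f (\<Union>(X ` (H \<inter> G)))"
        using H by (intro less.prems) auto
      moreover have "f (\<Union>(X ` (H \<inter> G))) \<le> f (S \<inter> T)"
        by (intro mono) (auto simp: S_def T_def)
      moreover have "f (S \<union> T) + f (S \<inter> T) \<le> card H + card G"
        using subm[of S T] H G by (simp add: S_def T_def)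
      moreover have "card H + card G = card (H \<union> G) + card (H \<inter> G)"
        using fHG by (rule card_Un_Int)
      ultimately show False by linarith
    qed
    then obtain z where z: "z \<in> {x, y}" "\<And>J'. J' \<subseteq> J \<Longrightarrow> card J' \<le> f (\<Union>(X' z ` J'))" by blast
    have zk: "z \<in> X k" using z xy by auto
    have "(\<Sum>i\<in>J. card (X' z i)) < (\<Sum>i\<in>J. card (X i))"
    proof (rule sum_strict_mono_ex1[OF fin])
      show "\<forall>i\<in>J. card (X' z i) \<le> card (X i)" by (auto simp: X'_def intro: card_mono)
      have "card (X' z k) < card (X k)" using zk unfolding X'_def fun_upd_same
        by (intro psubset_card_mono) auto
      then show "\<exists>i\<in>J. card (X' z i) < card (X i)" using k by blast
    qed
    from less.hyps[OF this z(2)] obtain Y where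
      Y: "\<forall>i\<in>J. Y i \<subseteq> X' z i \<and> card (Y i) \<le> 1" "\<forall>J'\<subseteq>J. card J' \<le> f (\<Union>(Y ` J'))" by blast
    moreover have "X' z i \<subseteq> X i" for i by (auto simp: X'_def)
    ultimately have "\<forall>i\<in>J. Y i \<subseteq> X i \<and> card (Y i) \<le> 1" by blast
    then show ?thesis using Y(2) by blast
  qed
qed

section \<open>Rank and symmetric exchange in a finite matroid\<close>

definition matroid_rank :: "('n::finite set \<Rightarrow> bool) \<Rightarrow> 'n set \<Rightarrow> nat" where
  "matroid_rank indep S = Max (card ` {I. I \<subseteq> S \<and> indep I})"

locale finite_matroid =
  fixes indep :: "'n::finite set \<Rightarrow> bool"
  assumes matroid: "matroid indep"
begin

abbreviation "rk \<equiv> matroid_rank indep"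

lemma indep_empty: "indep {}"
  and indep_subset: "indep J \<Longrightarrow> I \<subseteq> J \<Longrightarrow> indep I"
  and augment: "indep I \<Longrightarrow> indep J \<Longrightarrow> card I < card J \<Longrightarrow> \<exists>e\<in>J - I. indep (insert e I)"
  using matroid unfolding matroid_def by blast+

lemma card_le_rank: "I \<subseteq> S \<Longrightarrow> indep I \<Longrightarrow> card I \<le> rk S"
  unfolding matroid_rank_def by (intro Max_ge) auto

lemma rank_witness: "\<exists>I\<subseteq>S. indep I \<and> card I = rk S"
proof -
  have "rk S \<in> card ` {I. I \<subseteq> S \<and> indep I}"
    unfolding matroid_rank_def using indep_empty by (intro Max_in) auto
  then show ?thesis by auto
qed

lemma extend_indep:
  assumes "indep I" "I \<subseteq> S"
  shows "\<exists>J. I \<subseteq> J \<and> J \<subseteq> S \<and> indep J \<and> card J = rk S"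
  using assms
proof (induction "rk S - card I" arbitrary: I)
  case 0
  then show ?case using card_le_rank[of I S] by force
next
  case (Suc k)
  obtain L where L: "L \<subseteq> S" "indep L" "card L = rk S" using rank_witness by blast
  have "card I < card L" using Suc.hyps(2) L by linarith
  then obtain e where e: "e \<in> L - I" "indep (insert e I)"
    using augment Suc.prems L by blast
  have "card (insert e I) = Suc (card I)" using e by simp
  then have "k = rk S - card (insert e I)" using Suc.hyps(2) by linarith
  moreover have "insert e I \<subseteq> S" using Suc.prems e L by blast
  ultimately obtain J where "insert e I \<subseteq> J" "J \<subseteq> S" "indep J" "card J = rk S"
    using Suc.hyps(1) e by blast
  then show ?case by blast
qed

lemma rank_mono: "S \<subseteq> T \<Longrightarrow> rk S \<le> rk T"
  using rank_witness[of S] card_le_rank by (metis order.trans)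

lemma rank_le_card: "rk S \<le> card S"
  using rank_witness[of S] by (metis card_mono finite)

lemma rank_submodular: "rk (S \<union> T) + rk (S \<inter> T) \<le> rk S + rk T"
proof -
  obtain I where I: "I \<subseteq> S \<inter> T" "indep I" "card I = rk (S \<inter> T)" using rank_witness by blast
  then obtain J where J: "I \<subseteq> J" "J \<subseteq> S \<union> T" "indep J" "card J = rk (S \<union> T)"
    using extend_indep[of I "S \<union> T"] by blast
  have "card (J \<inter> S) \<le> rk S" "card (J \<inter> T) \<le> rk T"
    using J by (auto intro!: card_le_rank intro: indep_subset)
  moreover have "card (J \<inter> S) + card (J \<inter> T) = card (J \<inter> S \<union> J \<inter> T) + card (J \<inter> S \<inter> (J \<inter> T))"
    by (rule card_Un_Int) auto
  moreover have "J \<inter> S \<union> J \<inter> T = J" using J by auto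
  moreover have "card I \<le> card (J \<inter> S \<inter> (J \<inter> T))" using I J by (intro card_mono) auto
  ultimately show ?thesis using I J by simp
qed

lemma is_basis_iff: "is_basis indep B \<longleftrightarrow> indep B \<and> card B = rk UNIV"
proof
  assume B: "is_basis indep B"
  then obtain J where "B \<subseteq> J" "indep J" "card J = rk UNIV"
    using extend_indep[of B UNIV] by (auto simp: is_basis_def)
  then show "indep B \<and> card B = rk UNIV" using B by (auto simp: is_basis_def)
next
  assume B: "indep B \<and> card B = rk UNIV"
  have "C = B" if "indep C" "B \<subseteq> C" for C
    using card_le_rank[of C UNIV] that B by (metis card_seteq finite subset_UNIV)
  then show "is_basis indep B" using B by (auto simp: is_basis_def)
qed

lemma indep_iff_rank: "indep S \<longleftrightarrow> card S \<le> rk S"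
proof
  show "indep S \<Longrightarrow> card S \<le> rk S" by (rule card_le_rank) auto
  assume "card S \<le> rk S"
  then show "indep S" using rank_witness[of S] by (metis card_seteq finite)
qed

lemma card_swap: "c \<in> C \<Longrightarrow> b \<notin> C \<Longrightarrow> card (insert b (C - {c})) = card (C :: 'n set)"
  by (metis Diff_iff card_Suc_Diff1 card_insert_disjoint finite)

text \<open>The set \<open>insert b D\<close> is the fundamental circuit of \<open>b\<close> with
  respect to \<open>C\<close>. If no element of \<open>D\<close> could replace \<open>b\<close> in
  \<open>B\<close>, then \<open>D\<close> would lie in the span of \<open>I = B - {b}\<close>.
  Extending \<open>D\<close> to a maximal independent set \<open>J\<close> of
  \<open>I \<union> D\<close> and augmenting it from \<open>B\<close> must then add
  \<open>b\<close>, making the circuit independent.\<close>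

lemma symmetric_exchange:
  assumes B: "is_basis indep B" and C: "is_basis indep C" and b: "b \<in> B - C"
  shows "\<exists>c\<in>C - B. is_basis indep (insert c (B - {b})) \<and> is_basis indep (insert b (C - {c}))"
proof (rule ccontr)
  assume neg: "\<not> ?thesis"
  define D where "D = {c\<in>C. indep (insert b (C - {c}))}"
  define I where "I = B - {b}"
  have cB: "indep B" "card B = rk UNIV" and cC: "indep C" "card C = rk UNIV"
    using B C by (auto simp: is_basis_iff)
  have "indep I" using cB indep_subset[of B I] by (auto simp: I_def)
  moreover have "Suc (card I) = card B"
    unfolding I_def using b by (intro card_Suc_Diff1) auto
  ultimately have I: "indep I" "Suc (card I) = card B" .
  \<comment> \<open>A maximal independent extension inside \<open>insert b C\<close> would have the
    size of \<open>C\<close>, so it would omit exactly one \<open>c\<close> in \<open>C\<close>;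
    that \<open>c\<close> would belong to \<open>D\<close>, which the extension contains.\<close>
  have "\<not> indep (insert b D)"
  proof
    assume "indep (insert b D)"
    then obtain J where J: "insert b D \<subseteq> J" "J \<subseteq> insert b C" "indep J" "card J = rk (insert b C)"
      using extend_indep[of "insert b D" "insert b C"] by (auto simp: D_def)
    have "rk (insert b C) \<ge> card C" using cC card_le_rank by blast
    moreover have "card J \<le> rk UNIV" using J card_le_rank by blast
    ultimately have cJ: "card J = card C" using J cC by simp
    have "J \<noteq> insert b C" using cJ b by auto
    then obtain c where c: "c \<in> insert b C" "c \<notin> J" using J by blast
    then have cc: "c \<in> C" "c \<noteq> b" using J by auto
    have "J \<subseteq> insert b (C - {c})" using J c by auto
    moreover have "card (insert b (C - {c})) = card C" using cc b by (intro card_swap) auto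
    ultimately have "J = insert b (C - {c})" using cJ by (simp add: card_seteq)
    then have "c \<in> D" using J cc by (simp add: D_def)
    then show False using J c by auto
  qed
  have closed: "\<not> indep (insert c I)" if "c \<in> D" "c \<notin> I" for c
  proof
    assume ind: "indep (insert c I)"
    have c: "c \<in> C" "c \<noteq> b" using that b by (auto simp: D_def)
    then have "c \<in> C - B" using that by (auto simp: I_def)
    moreover have "is_basis indep (insert c (B - {b}))"
      using ind cB b \<open>c \<in> C - B\<close> card_swap[of b B c] by (simp add: is_basis_iff I_def)
    moreover have "is_basis indep (insert b (C - {c}))"
      using that(1) c b cC card_swap[of c C b] by (simp add: is_basis_iff D_def)
    ultimately show False using neg by blast
  qed
  have rkI: "rk (I \<union> D) = card I"
  proof -
    obtain J where J: "I \<subseteq> J" "J \<subseteq> I \<union> D" "indep J" "card J = rk (I \<union> D)"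
      using extend_indep[of I "I \<union> D"] I by auto
    have "J = I"
    proof (rule ccontr)
      assume "J \<noteq> I"
      then obtain c where "c \<in> J" "c \<notin> I" using J by auto
      then show False using closed[of c] J indep_subset[of J "insert c I"] by auto
    qed
    then show ?thesis using J by simp
  qed
  have "indep D" using cC indep_subset by (auto simp: D_def)
  then obtain J where J: "D \<subseteq> J" "J \<subseteq> I \<union> D" "indep J" "card J = card I"
    using extend_indep[of D "I \<union> D"] rkI by auto
  then obtain e where e: "e \<in> B - J" "indep (insert e J)"
    using augment[of J B] I cB by auto
  show False
  proof (cases "e = b")
    case True
    then show False using e J indep_subset[of "insert e J" "insert b D"] \<open>\<not> indep (insert b D)\<close> by auto
  next
    case False
    then have "insert e J \<subseteq> I \<union> D" using e J by (auto simp: I_def)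
    then have "card (insert e J) \<le> card I" using e card_le_rank rkI by metis
    then show False using e J by simp
  qed
qed

text \<open>The pair \<open>(a, b)\<close> has capacity at least \<open>N\<close>: between \<open>\<kappa>\<close>-classes, up to \<open>N\<close> units can be
  moved from the class of \<open>a\<close> to that of \<open>b\<close>.\<close>
definition robust_pair :: "('n \<Rightarrow> 't) \<Rightarrow> 'n set \<Rightarrow> nat \<Rightarrow> 'n \<Rightarrow> 'n \<Rightarrow> bool" where
  "robust_pair \<kappa> A N a b \<longleftrightarrow>
     (\<forall>U. \<kappa> b \<in> U \<and> \<kappa> a \<notin> U \<longrightarrow> card (A \<inter> \<kappa> -` U) + N \<le> rk (\<kappa> -` U))"

lemma exchange_robust_pairs:
  assumes A: "is_basis indep A" and Z: "Z \<subseteq> A" "card Z \<le> N"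
    and \<beta>: "inj_on \<beta> Z" "\<beta> ` Z \<inter> A = {}"
    and robust: "\<And>a. a \<in> Z \<Longrightarrow> robust_pair \<kappa> A N a (\<beta> a)"
  shows "\<exists>x A'. is_basis indep A' \<and> bij_betw x ((A - Z) \<union> \<beta> ` Z) A' \<and>
    (\<forall>e\<in>(A - Z) \<union> \<beta> ` Z. \<kappa> (x e) = \<kappa> e)"
proof -
  define J where "J = (A - Z) \<union> \<beta> ` Z"
  define X where "X e = {e'. \<kappa> e' = \<kappa> e}" for e
  have A': "indep A" "card A = rk UNIV" using A by (auto simp: is_basis_iff)
  have split: "card (J \<inter> S) = card (A \<inter> S - Z) + card {a\<in>Z. \<beta> a \<in> S}" for S
  proof -
    have "J \<inter> S = (A \<inter> S - Z) \<union> \<beta> ` {a\<in>Z. \<beta> a \<in> S}" by (auto simp: J_def)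
    moreover have "card (\<beta> ` {a\<in>Z. \<beta> a \<in> S}) = card {a\<in>Z. \<beta> a \<in> S}"
      using \<beta>(1) by (intro card_image) (auto simp: inj_on_def)
    moreover have "(A \<inter> S - Z) \<inter> \<beta> ` {a\<in>Z. \<beta> a \<in> S} = {}" using \<beta>(2) by auto
    ultimately show ?thesis by (simp add: card_Un_disjoint)
  qed
  have key: "card (J \<inter> \<kappa> -` U) \<le> rk (\<kappa> -` U)" for U
  proof (cases "\<exists>a\<in>Z. \<kappa> (\<beta> a) \<in> U \<and> \<kappa> a \<notin> U")
    case True
    then have "card (A \<inter> \<kappa> -` U) + N \<le> rk (\<kappa> -` U)"
      using robust by (auto simp: robust_pair_def)
    moreover have "card (A \<inter> \<kappa> -` U - Z) \<le> card (A \<inter> \<kappa> -` U)" by (intro card_mono) auto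
    moreover have "card {a\<in>Z. \<beta> a \<in> \<kappa> -` U} \<le> card Z" by (intro card_mono) auto
    ultimately show ?thesis using split[of "\<kappa> -` U"] Z by simp
  next
    case False
    then have "{a\<in>Z. \<beta> a \<in> \<kappa> -` U} \<subseteq> A \<inter> \<kappa> -` U \<inter> Z" using Z by auto
    then have "card {a\<in>Z. \<beta> a \<in> \<kappa> -` U} \<le> card (A \<inter> \<kappa> -` U \<inter> Z)" by (intro card_mono) auto
    moreover have "card (A \<inter> \<kappa> -` U) = card (A \<inter> \<kappa> -` U - Z) + card (A \<inter> \<kappa> -` U \<inter> Z)"
      using card_Int_Diff[of "A \<inter> \<kappa> -` U" Z] by simp
    moreover have "card (A \<inter> \<kappa> -` U) \<le> rk (\<kappa> -` U)"
      using A' by (intro card_le_rank) (auto intro: indep_subset)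
    ultimately show ?thesis using split[of "\<kappa> -` U"] by simp
  qed
  have "card J' \<le> rk (\<Union>(X ` J'))" if "J' \<subseteq> J" for J'
  proof -
    have "\<Union>(X ` J') = \<kappa> -` (\<kappa> ` J')" by (auto simp: X_def)
    moreover have "card J' \<le> card (J \<inter> \<kappa> -` (\<kappa> ` J'))" using that by (intro card_mono) auto
    ultimately show ?thesis using key[of "\<kappa> ` J'"] by simp
  qed
  then have "\<exists>Y. (\<forall>i\<in>J. Y i \<subseteq> X i \<and> card (Y i) \<le> 1) \<and> (\<forall>J'\<subseteq>J. card J' \<le> rk (\<Union>(Y ` J')))"
    by (intro rado rank_mono rank_submodular) auto
  then obtain Y where
    Y: "\<forall>i\<in>J. Y i \<subseteq> X i \<and> card (Y i) \<le> 1" "\<forall>J'\<subseteq>J. card J' \<le> rk (\<Union>(Y ` J'))"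
    by blast
  \<comment> \<open>Rado's condition on the single index \<open>e\<close> excludes an empty
    part.\<close>
  have "\<exists>y. Y e = {y}" if "e \<in> J" for e
  proof -
    have "1 \<le> rk (Y e)" using Y(2)[rule_format, of "{e}"] that by simp
    then have "1 \<le> card (Y e)" using rank_le_card[of "Y e"] by linarith
    then show ?thesis using Y(1) that by (metis card_1_singletonE le_antisym)
  qed
  then obtain x where x: "\<And>e. e \<in> J \<Longrightarrow> Y e = {x e}" by metis
  have "\<Union>(Y ` J) = x ` J" using x by auto
  then have c: "card J \<le> rk (x ` J)" using Y(2)[rule_format, of J] by simp
  moreover have "card (x ` J) \<le> card J" by (simp add: card_image_le)
  ultimately have cx: "card (x ` J) = card J" and ind: "indep (x ` J)"
    using rank_le_card[of "x ` J"] indep_iff_rank[of "x ` J"] by auto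
  have "card J = card A"
    using split[of UNIV] Z by (simp add: card_Diff_subset card_mono finite_subset)
  then have "is_basis indep (x ` J)" using ind cx A' by (simp add: is_basis_iff)
  moreover have "bij_betw x J (x ` J)" using cx by (simp add: bij_betw_def eq_card_imp_inj_on)
  moreover have "\<forall>e\<in>J. \<kappa> (x e) = \<kappa> e" using Y(1) x by (auto simp: X_def)
  ultimately show ?thesis unfolding J_def by blast
qed

text \<open>The deficiency version of Hall's theorem reduces the claim to \<open>hall\<close>.
  There, every class in \<open>Y\<close> is separated from every class of \<open>A - B\<close>
  outside the neighbourhood \<open>\<Gamma>\<close> by a set of small slack. Uncrossing these at
  most \<open>\<tau> * \<tau>\<close> sets gives one set \<open>V\<close> of slack at most
  \<open>h\<close> that contains \<open>Y\<close> and misses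
  \<open>A - B - \<Gamma>\<close>.\<close>

lemma many_robust_pairs:
  assumes A: "is_basis indep A" and B: "is_basis indep B"
    and \<tau>: "card (\<kappa> ` (A - B)) \<le> \<tau>" "card (\<kappa> ` (B - A)) \<le> \<tau>"
  shows "\<exists>Q \<beta>. Q \<subseteq> A - B \<and> inj_on \<beta> Q \<and> \<beta> ` Q \<subseteq> B - A \<and>
    (\<forall>a\<in>Q. robust_pair \<kappa> A N a (\<beta> a)) \<and> card (A - B) \<le> card Q + \<tau> * \<tau> * N"
proof -
  have iA: "indep A" "card A = rk UNIV" and iB: "indep B" "card B = rk UNIV"
    using A B by (auto simp: is_basis_iff)
  define h where "h = \<tau> * \<tau> * N"
  define slack where "slack S = int (rk S) - int (card (A \<inter> S))" for S
  have slack0: "slack S \<ge> 0" for S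
    using iA by (auto simp: slack_def intro!: card_le_rank intro: indep_subset)
  have slack_sub: "slack (S \<union> T) + slack (S \<inter> T) \<le> slack S + slack T" for S T
  proof -
    have "card (A \<inter> S) + card (A \<inter> T) = card (A \<inter> S \<union> A \<inter> T) + card (A \<inter> S \<inter> (A \<inter> T))"
      by (rule card_Un_Int) auto
    moreover have "A \<inter> S \<union> A \<inter> T = A \<inter> (S \<union> T)" "A \<inter> S \<inter> (A \<inter> T) = A \<inter> (S \<inter> T)" by auto
    ultimately show ?thesis using rank_submodular[of S T] by (simp add: slack_def)
  qed
  have slack_Un: "slack (\<Union>t\<in>P. V t) \<le> (\<Sum>t\<in>P. slack (V t))" if "finite P"
    for P :: "'t set" and V
    using that
  proof induction
    case empty
    then show ?case using rank_le_card[of "{}"] by (simp add: slack_def)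
  next
    case (insert t P)
    then show ?case using slack_sub[of "V t" "\<Union>t\<in>P. V t"] slack0[of "V t \<inter> (\<Union>t\<in>P. V t)"] by simp
  qed
  have slack_Int: "slack (\<Inter>t\<in>P. V t) \<le> (\<Sum>t\<in>P. slack (V t))" if "finite P"
    for P :: "'t set" and V
    using that
  proof induction
    case empty
    then show ?case using iA by (simp add: slack_def)
  next
    case (insert t P)
    then show ?case using slack_sub[of "V t" "\<Inter>t\<in>P. V t"] slack0[of "V t \<union> (\<Inter>t\<in>P. V t)"] by simp
  qed
  define X where "X b = {a\<in>A - B. robust_pair \<kappa> A N a b}" for b
  have hall: "card Y \<le> card (\<Union>(X ` Y)) + h" if Y: "Y \<subseteq> B - A" for Y
  proof -
    define \<Gamma> where "\<Gamma> = \<Union>(X ` Y)"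
    have \<Gamma>: "\<Gamma> \<subseteq> A - B" by (auto simp: \<Gamma>_def X_def)
    define S where "S = \<kappa> ` (A - B - \<Gamma>)"
    define T where "T = \<kappa> ` Y"
    have ST: "finite S" "finite T" "card S \<le> \<tau>" "card T \<le> \<tau>"
      using order.trans[OF card_mono \<tau>(1), of S] order.trans[OF card_mono \<tau>(2), of T] Y
      by (auto simp: S_def T_def)
    have "\<exists>U. t \<in> U \<and> s \<notin> U \<and> slack (\<kappa> -` U) \<le> int N" if st: "t \<in> T" "s \<in> S" for s t
    proof -
      obtain a b where ab: "a \<in> A - B - \<Gamma>" "s = \<kappa> a" "b \<in> Y" "t = \<kappa> b"
        using st by (auto simp: S_def T_def)
      then have "\<not> robust_pair \<kappa> A N a b" by (auto simp: \<Gamma>_def X_def)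
      then show ?thesis using ab by (force simp: robust_pair_def slack_def)
    qed
    note bad = this
    \<comment> \<open>One separating set is fixed per pair of classes, not per pair of elements, so
      the number of slack terms does not depend on \<open>card (A - B)\<close>.\<close>
    define U where "U s t = (SOME U. t \<in> U \<and> s \<notin> U \<and> slack (\<kappa> -` U) \<le> int N)" for s t
    have U: "t \<in> U s t \<and> s \<notin> U s t \<and> slack (\<kappa> -` U s t) \<le> int N" if "t \<in> T" "s \<in> S" for s t
      unfolding U_def using someI_ex[OF bad[OF that]] .
    define V where "V = (\<Union>t\<in>T. \<Inter>s\<in>S. \<kappa> -` U s t)"
    have "slack V \<le> (\<Sum>t\<in>T. slack (\<Inter>s\<in>S. \<kappa> -` U s t))"
      unfolding V_def using ST by (intro slack_Un)
    also have "\<dots> \<le> (\<Sum>t\<in>T. \<Sum>s\<in>S. slack (\<kappa> -` U s t))"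
      using ST by (intro sum_mono slack_Int)
    also have "\<dots> \<le> (\<Sum>t\<in>T. \<Sum>s\<in>S. int N)" using U by (intro sum_mono) auto
    also have "\<dots> = int (card T * card S * N)" by simp
    also have "\<dots> \<le> int h" unfolding h_def using ST by (simp only: of_nat_le_iff mult_mono)
    finally have sV: "slack V \<le> int h" .
    have "Y \<subseteq> V" using U by (auto simp: V_def T_def)
    \<comment> \<open>\<open>Y\<close> and \<open>A \<inter> B \<inter> V\<close> are disjoint parts
      of the independent set \<open>B \<inter> V\<close>, so the rank of \<open>V\<close> is large,
      whereas \<open>A \<inter> V\<close> lies in
      \<open>A \<inter> B \<inter> V \<union> \<Gamma>\<close>. The small slack of \<open>V\<close>
      then forces \<open>\<Gamma>\<close> to be large.\<close>
    then have "card Y + card (A \<inter> B \<inter> V) \<le> card (B \<inter> V)"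
      using Y by (subst card_Un_disjoint[symmetric]) (auto intro!: card_mono)
    also have "\<dots> \<le> rk V" using iB by (intro card_le_rank) (auto intro: indep_subset)
    finally have 1: "card Y + card (A \<inter> B \<inter> V) \<le> rk V" .
    have "(A - B) \<inter> V \<subseteq> \<Gamma>"
    proof
      fix a assume a: "a \<in> (A - B) \<inter> V"
      show "a \<in> \<Gamma>"
      proof (rule ccontr)
        assume "a \<notin> \<Gamma>"
        then have "\<kappa> a \<in> S" using a by (auto simp: S_def)
        then show False using a U unfolding V_def by auto
      qed
    qed
    then have "card (A \<inter> V) \<le> card (A \<inter> B \<inter> V \<union> \<Gamma>)" by (intro card_mono) auto
    also have "\<dots> \<le> card (A \<inter> B \<inter> V) + card \<Gamma>" by (rule card_Un_le)
    finally show ?thesis using 1 sV by (simp add: slack_def \<Gamma>_def)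
  qed
  have "\<exists>Y. (\<forall>i\<in>B - A. Y i \<subseteq> X i \<and> card (Y i) \<le> 1) \<and>
      (\<forall>J'\<subseteq>B - A. card J' \<le> card (\<Union>(Y ` J')) + h)"
  proof (rule rado[where f = "\<lambda>S. card S + h"])
    show "card (S \<union> T) + h + (card (S \<inter> T) + h) \<le> card S + h + (card T + h)" for S T :: "'n set"
      using card_Un_Int[of S T] by simp
  qed (auto intro: card_mono hall)
  then obtain Y where Y: "\<forall>i\<in>B - A. Y i \<subseteq> X i \<and> card (Y i) \<le> 1"
    "card (B - A) \<le> card (\<Union>(Y ` (B - A))) + h" by blast
  \<comment> \<open>The nonempty parts select the matched elements. Each part has at most one
    element, so any choice of a partner \<open>\<beta> a\<close> with
    \<open>a \<in> Y (\<beta> a)\<close> is injective.\<close>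
  define Q where "Q = \<Union>(Y ` (B - A))"
  have "\<exists>b\<in>B - A. a \<in> Y b" if "a \<in> Q" for a using that by (auto simp: Q_def)
  then obtain \<beta> where \<beta>: "\<And>a. a \<in> Q \<Longrightarrow> \<beta> a \<in> B - A \<and> a \<in> Y (\<beta> a)" by metis
  have "inj_on \<beta> Q"
  proof (rule inj_onI)
    fix a a' assume aa: "a \<in> Q" "a' \<in> Q" "\<beta> a = \<beta> a'"
    then have "a \<in> Y (\<beta> a)" "a' \<in> Y (\<beta> a)" "card (Y (\<beta> a)) \<le> Suc 0" using \<beta> Y(1) by (metis One_nat_def)+
    then show "a = a'" by (metis card_le_Suc0_iff_eq finite)
  qed
  moreover have "card (A - B) = card (B - A)"
    using iA iB card_Int_Diff[of A B] card_Int_Diff[of B A] by (simp add: Int_commute)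
  moreover have "\<forall>a\<in>Q. a \<in> A - B \<and> robust_pair \<kappa> A N a (\<beta> a)"
    using \<beta> Y(1) by (force simp: X_def)
  moreover have "\<beta> ` Q \<subseteq> B - A" using \<beta> by blast
  ultimately show ?thesis using Y(2) unfolding Q_def[symmetric] h_def by (metis subsetI)
qed

end

section \<open>Vertices of the weight-constrained base polytope\<close>

lemma charvec_exchange:
  assumes "b \<in> B" "c \<notin> B"
  shows "charvec (insert c (B - {b})) - charvec B = axis c 1 - (axis b 1 :: real^'n::finite)"
  using assms by (auto simp: vec_eq_iff charvec_def axis_def)

lemma wmult_linear: "linear (wmult W)"
  by (rule linearI)
    (simp_all add: wmult_def vec_eq_iff sum.distrib sum_distrib_left algebra_simps)

lemma l1dist_charvec: "l1dist (charvec C) (charvec B) = real (card (B - C) + card (C - B))"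
proof -
  have "l1dist (charvec C) (charvec B) = (\<Sum>e\<in>UNIV. if e \<in> (B - C) \<union> (C - B) then 1 else 0)"
    unfolding l1dist_def charvec_def by (intro sum.cong) auto
  also have "\<dots> = real (card ((B - C) \<union> (C - B)))" by (auto simp: sum.If_cases intro!: arg_cong[where f = card])
  finally show ?thesis by (subst (asm) card_Un_disjoint) auto
qed

definition basis_weights :: "('n::finite set \<Rightarrow> bool) \<Rightarrow> real^'n \<Rightarrow> ('n set \<Rightarrow> real) \<Rightarrow> bool" where
  "basis_weights indep y \<mu> \<longleftrightarrow> (\<forall>C. is_basis indep C \<longrightarrow> 0 \<le> \<mu> C) \<and>
     sum \<mu> {C. is_basis indep C} = 1 \<and>
     (\<Sum>C | is_basis indep C. \<mu> C *\<^sub>R charvec C) = y"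

text \<open>Asserting positivity for one of the two new bases suffices: interchanging
  \<open>B\<close> with \<open>C\<close> and \<open>b\<close> with \<open>c\<close> gives the
  other.\<close>

definition exchange_closed :: "('n::finite set \<Rightarrow> bool) \<Rightarrow> ('n set \<Rightarrow> real) \<Rightarrow> bool" where
  "exchange_closed indep \<mu> \<longleftrightarrow> (\<forall>B C b c. is_basis indep B \<and> is_basis indep C \<and>
     0 < \<mu> B \<and> 0 < \<mu> C \<and> b \<in> B - C \<and> c \<in> C - B \<and>
     is_basis indep (insert c (B - {b})) \<and> is_basis indep (insert b (C - {c})) \<longrightarrow>
     0 < \<mu> (insert c (B - {b})))"

lemma base_polytope_weights: "y \<in> base_polytope indep \<longleftrightarrow> (\<exists>\<mu>. basis_weights indep y \<mu>)"
proof -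
  let ?P = "{C. is_basis indep C}"
  have inj: "inj_on charvec ?P"
    by (auto simp: inj_on_def charvec_def vec_eq_iff split: if_splits)
  have eq: "{charvec B | B. is_basis indep B} = charvec ` ?P" by auto
  show ?thesis
  proof
    assume "y \<in> base_polytope indep"
    then obtain u where u: "\<forall>x\<in>charvec ` ?P. 0 \<le> u x" "sum u (charvec ` ?P) = 1"
      "(\<Sum>x\<in>charvec ` ?P. u x *\<^sub>R x) = y"
      unfolding base_polytope_def eq by (subst (asm) convex_hull_finite) auto
    then have "basis_weights indep y (u \<circ> charvec)"
      using inj by (auto simp: basis_weights_def sum.reindex o_def)
    then show "\<exists>\<mu>. basis_weights indep y \<mu>" by blast
  next
    assume "\<exists>\<mu>. basis_weights indep y \<mu>"
    then obtain \<mu> where \<mu>: "\<forall>C\<in>?P. 0 \<le> \<mu> C" "sum \<mu> ?P = 1" "(\<Sum>C\<in>?P. \<mu> C *\<^sub>R charvec C) = y"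
      by (auto simp: basis_weights_def)
    have "(\<Sum>C\<in>?P. \<mu> C *\<^sub>R charvec C) \<in> convex hull (charvec ` ?P)"
      using \<mu> by (intro convex_sum) (auto simp: convex_convex_hull hull_inc)
    then show "y \<in> base_polytope indep" using \<mu> by (simp add: base_polytope_def eq)
  qed
qed

context finite_matroid
begin

text \<open>The bases that carry positive weight in a representation of maximal support are the
  vertices of the minimal face of \<open>y\<close>.\<close>
lemma exchange_closed_weights:
  assumes "basis_weights indep y \<mu>0"
  shows "\<exists>\<mu>. basis_weights indep y \<mu> \<and> exchange_closed indep \<mu>"
proof -
  let ?P = "{C. is_basis indep C}"
  define supp where "supp \<mu> = {C\<in>?P. 0 < \<mu> C}" for \<mu> :: "'n set \<Rightarrow> real"
  have "card (supp \<mu>) < Suc (card ?P)" for \<mu>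
    by (auto simp: supp_def less_Suc_eq_le intro!: card_mono)
  then obtain \<mu> where \<mu>: "basis_weights indep y \<mu>"
    and max: "\<And>\<nu>. basis_weights indep y \<nu> \<Longrightarrow> card (supp \<nu>) \<le> card (supp \<mu>)"
    using ex_has_greatest_nat[of "basis_weights indep y" \<mu>0 "\<lambda>\<mu>. card (supp \<mu>)" "Suc (card ?P)"] assms
    by blast
  have "0 < \<mu> B'" if *: "is_basis indep B" "is_basis indep C" "0 < \<mu> B" "0 < \<mu> C"
      "b \<in> B - C" "c \<in> C - B" "is_basis indep B'" "is_basis indep C'"
      "B' = insert c (B - {b})" "C' = insert b (C - {c})" for B C b c B' C'
  proof (rule ccontr)
    assume neg: "\<not> 0 < \<mu> B'"
    define \<epsilon> where "\<epsilon> = min (\<mu> B) (\<mu> C) / 2"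
    have \<epsilon>: "0 < \<epsilon>" "\<epsilon> < \<mu> B" "\<epsilon> < \<mu> C" using * by (auto simp: \<epsilon>_def min_def)
    define \<delta> :: "'n set \<Rightarrow> 'n set \<Rightarrow> real" where "\<delta> E D = (if D = E then 1 else 0)" for E D
    \<comment> \<open>Shifting weight \<epsilon> from \<open>B\<close> and \<open>C\<close> to
      \<open>B'\<close> and \<open>C'\<close> keeps the represented point, since the two exchanges
      have opposite directions. As \<epsilon> is below both weights, no basis leaves the support,
      while \<open>B'\<close> enters it, contradicting maximality.\<close>
    define \<nu> where "\<nu> D = \<mu> D + \<epsilon> * (\<delta> B' D + \<delta> C' D - \<delta> B D - \<delta> C D)" for D
    have BC: "B \<noteq> C" using * by auto
    have \<mu>0: "0 \<le> \<mu> D" if "is_basis indep D" for D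
      using \<mu> that by (auto simp: basis_weights_def)
    have pos: "0 < \<nu> D" if D: "D \<in> supp \<mu> \<union> {B'}" for D
    proof -
      have "0 \<le> \<epsilon> * \<delta> B' D" "0 \<le> \<epsilon> * \<delta> C' D" using \<epsilon> by (auto simp: \<delta>_def)
      moreover have "\<nu> D = \<mu> D + \<epsilon> * \<delta> B' D + \<epsilon> * \<delta> C' D - \<epsilon> * \<delta> B D - \<epsilon> * \<delta> C D"
        by (simp add: \<nu>_def algebra_simps)
      moreover have "\<epsilon> * \<delta> B D + \<epsilon> * \<delta> C D < \<mu> D + \<epsilon> * \<delta> B' D"
      proof (cases "D = B \<or> D = C")
        case True
        then have "\<epsilon> * \<delta> B D + \<epsilon> * \<delta> C D = \<epsilon>" using BC by (auto simp: \<delta>_def)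
        then show ?thesis using True \<epsilon> \<open>0 \<le> \<epsilon> * \<delta> B' D\<close> by auto
      next
        case False
        then have "\<epsilon> * \<delta> B D + \<epsilon> * \<delta> C D = 0" by (simp add: \<delta>_def)
        moreover have "0 < \<mu> D + \<epsilon> * \<delta> B' D"
        proof (cases "D = B'")
          case True
          then show ?thesis using \<epsilon> \<mu>0[of B'] *(7) by (simp add: \<delta>_def)
        next
          case False
          then show ?thesis using D by (simp add: \<delta>_def supp_def)
        qed
        ultimately show ?thesis by simp
      qed
      ultimately show ?thesis by linarith
    qed
    have nn: "0 \<le> \<nu> D" if "is_basis indep D" for D
    proof (cases "D \<in> supp \<mu>")
      case True then show ?thesis using pos by force
    next
      case False
      then have "D \<noteq> B" "D \<noteq> C" using * by (auto simp: supp_def)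
      then show ?thesis using \<epsilon> \<mu>0[OF that] by (auto simp: \<nu>_def \<delta>_def)
    qed
    have s1: "sum (\<delta> E) ?P = 1" if "is_basis indep E" for E
      using that by (simp add: \<delta>_def)
    have s2: "(\<Sum>D\<in>?P. \<delta> E D *\<^sub>R charvec D) = charvec E" if "is_basis indep E" for E
    proof -
      have "(\<Sum>D\<in>?P. \<delta> E D *\<^sub>R charvec D) = (\<Sum>D\<in>?P. if D = E then charvec D else 0)"
        by (rule sum.cong) (auto simp: \<delta>_def)
      then show ?thesis using that by simp
    qed
    have "sum \<nu> ?P = sum \<mu> ?P + \<epsilon> * (sum (\<delta> B') ?P + sum (\<delta> C') ?P - sum (\<delta> B) ?P - sum (\<delta> C) ?P)"
      by (simp add: \<nu>_def sum.distrib sum_subtractf flip: sum_distrib_left)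
    then have t1: "sum \<nu> ?P = 1" using s1 * \<mu> by (simp add: basis_weights_def)
    have "(\<Sum>D\<in>?P. \<nu> D *\<^sub>R charvec D) = (\<Sum>D\<in>?P. \<mu> D *\<^sub>R charvec D + \<epsilon> *\<^sub>R (\<delta> B' D *\<^sub>R charvec D
        + \<delta> C' D *\<^sub>R charvec D - \<delta> B D *\<^sub>R charvec D - \<delta> C D *\<^sub>R charvec D))"
      by (rule sum.cong) (auto simp: \<nu>_def algebra_simps)
    also have "\<dots> = (\<Sum>D\<in>?P. \<mu> D *\<^sub>R charvec D) + \<epsilon> *\<^sub>R ((\<Sum>D\<in>?P. \<delta> B' D *\<^sub>R charvec D)
        + (\<Sum>D\<in>?P. \<delta> C' D *\<^sub>R charvec D) - (\<Sum>D\<in>?P. \<delta> B D *\<^sub>R charvec D) - (\<Sum>D\<in>?P. \<delta> C D *\<^sub>R charvec D))"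
      by (simp only: sum.distrib sum_subtractf scaleR_right.sum[symmetric])
    also have "\<dots> = y + \<epsilon> *\<^sub>R (charvec B' + charvec C' - charvec B - charvec C)"
      using s2 * \<mu> by (simp add: basis_weights_def)
    also have "charvec B' + charvec C' - charvec B - charvec C
        = (charvec B' - charvec B) + (charvec C' - charvec C)" by simp
    also have "\<dots> = 0"
      using charvec_exchange[of b B c] charvec_exchange[of c C b] *(5,6,9,10) by simp
    finally have "(\<Sum>D\<in>?P. \<nu> D *\<^sub>R charvec D) = y" by simp
    then have "basis_weights indep y \<nu>" using nn t1 by (simp add: basis_weights_def)
    then have "card (supp \<nu>) \<le> card (supp \<mu>)" by (rule max)
    moreover have "insert B' (supp \<mu>) \<subseteq> supp \<nu>" using pos * by (auto simp: supp_def)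
    then have "card (insert B' (supp \<mu>)) \<le> card (supp \<nu>)" by (intro card_mono) auto
    moreover have "card (insert B' (supp \<mu>)) = Suc (card (supp \<mu>))"
      using neg by (simp add: supp_def)
    ultimately show False by simp
  qed
  from this[OF _ _ _ _ _ _ _ _ refl refl] have "exchange_closed indep \<mu>"
    unfolding exchange_closed_def by blast
  then show ?thesis using \<mu> by blast
qed

text \<open>More than \<open>m\<close> exchange directions have linearly dependent images under
  \<open>W\<close>, which gives a nonzero \<open>v\<close> in the kernel. Since \<open>v\<close>
  combines differences of bases of positive weight, a small move along either sign of
  \<open>v\<close> stays in the polytope, contradicting extremality.\<close>

lemma extreme_support_close:
  fixes W :: "int^'n^'m::finite"
  assumes ext: "xs extreme_point_of (base_polytope indep \<inter> {x. wmult W x = w})"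
    and \<mu>: "basis_weights indep xs \<mu>"
    and closed: "exchange_closed indep \<mu>"
    and B: "is_basis indep B" "0 < \<mu> B" and C: "is_basis indep C" "0 < \<mu> C"
  shows "card (B - C) \<le> CARD('m)"
proof (rule ccontr)
  assume large: "\<not> card (B - C) \<le> CARD('m)"
  let ?P = "{C. is_basis indep C}"
  define \<S> where "\<S> = {C\<in>?P. 0 < \<mu> C}"
  text \<open>The exchanges on a path from \<open>B\<close> to \<open>C\<close> inside the minimal face have disjoint supports,
    so their directions are linearly independent.\<close>
  have "\<exists>\<phi> D D'. \<forall>b\<in>B - C. \<phi> b \<in> C - B \<and> D b \<in> \<S> \<and> D' b \<in> \<S> \<and>
      charvec (D' b) - charvec (D b) = axis (\<phi> b) 1 - (axis b 1 :: real^'n)"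
    if "B \<in> \<S>" "C \<in> \<S>" for B C
    using that
  proof (induction "card (B - C)" arbitrary: B)
    case 0
    then have "B - C = {}" by simp
    then show ?case by blast
  next
    case (Suc k)
    then have "B - C \<noteq> {}" by (metis card.empty nat.distinct(1))
    then obtain b where b: "b \<in> B - C" by blast
    have BC: "is_basis indep B" "is_basis indep C" "0 < \<mu> B" "0 < \<mu> C"
      using Suc.prems by (auto simp: \<S>_def)
    obtain c where c: "c \<in> C - B" "is_basis indep (insert c (B - {b}))"
      "is_basis indep (insert b (C - {c}))"
      using symmetric_exchange[OF BC(1,2) b] by blast
    define B' where "B' = insert c (B - {b})"
    have B': "B' \<in> \<S>"
      using closed[unfolded exchange_closed_def, rule_format, of B C b c] BC b c
      by (simp add: \<S>_def B'_def)
    have d: "B' - C = B - C - {b}" "C - B' = C - B - {c}" using b c by (auto simp: B'_def)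
    then have "k = card (B' - C)" using Suc.hyps(2) b by simp
    from Suc.hyps(1)[OF this B' Suc.prems(2)] obtain \<phi> D D' where
      IH: "\<forall>b\<in>B' - C. \<phi> b \<in> C - B' \<and> D b \<in> \<S> \<and> D' b \<in> \<S> \<and>
        charvec (D' b) - charvec (D b) = axis (\<phi> b) 1 - (axis b 1 :: real^'n)" by blast
    have "(\<phi>(b := c)) a \<in> C - B \<and> (D(b := B)) a \<in> \<S> \<and> (D'(b := B')) a \<in> \<S> \<and>
        charvec ((D'(b := B')) a) - charvec ((D(b := B)) a) =
          axis ((\<phi>(b := c)) a) 1 - (axis a 1 :: real^'n)" if "a \<in> B - C" for a
    proof (cases "a = b")
      case True
      then show ?thesis
        using b c(1) B' Suc.prems charvec_exchange[of b B c] by (simp add: B'_def)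
    next
      case False
      then show ?thesis using IH that unfolding d by simp
    qed
    then show ?case by blast
  qed
  then obtain \<phi> D D' where \<phi>: "\<And>b. b \<in> B - C \<Longrightarrow> \<phi> b \<in> C - B \<and> D b \<in> \<S> \<and> D' b \<in> \<S> \<and>
      charvec (D' b) - charvec (D b) = axis (\<phi> b) 1 - (axis b 1 :: real^'n)"
    using B C by (metis (no_types, lifting) \<S>_def mem_Collect_eq)
  define d where "d b = (axis (\<phi> b) 1 - axis b 1 :: real^'n)" for b
  obtain \<alpha> where \<alpha>: "\<exists>b\<in>B - C. \<alpha> b \<noteq> 0" "(\<Sum>b\<in>B - C. \<alpha> b *\<^sub>R wmult W (d b)) = 0"
    using family_dependence[of "B - C" "\<lambda>b. wmult W (d b)"] large by auto
  define v where "v = (\<Sum>b\<in>B - C. \<alpha> b *\<^sub>R d b)"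
  have "wmult W v = 0"
    using \<alpha>(2) by (simp add: v_def linear_sum[OF wmult_linear] linear_scale[OF wmult_linear])
  have "v \<noteq> 0"
  proof -
    obtain b where b: "b \<in> B - C" "\<alpha> b \<noteq> 0" using \<alpha> by blast
    \<comment> \<open>Since \<phi> maps into \<open>C - B\<close>, coordinate \<open>b\<close>
      occurs in no direction other than \<open>d b\<close>, so nothing cancels it.\<close>
    have "v $ b = (\<Sum>b'\<in>B - C. \<alpha> b' * (d b' $ b))" by (simp add: v_def)
    also have "\<dots> = (\<Sum>b'\<in>B - C. if b' = b then - \<alpha> b else 0)"
      using \<phi> b by (intro sum.cong) (auto simp: d_def axis_def)
    also have "\<dots> = - \<alpha> b" using b by simp
    finally show ?thesis using b by auto
  qed
  \<comment> \<open>These are the coefficients of \<open>v\<close> over the bases: they sum to zero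
    and vanish off the support, so \<mu> can be perturbed by small multiples of them.\<close>
  define \<nu> where "\<nu> E = (\<Sum>b\<in>B - C. \<alpha> b * ((if E = D' b then 1 else 0) - (if E = D b then 1 else 0)))"
    for E :: "'n set"
  have DP: "D b \<in> ?P" "D' b \<in> ?P" if "b \<in> B - C" for b using \<phi>[OF that] by (auto simp: \<S>_def)
  have \<nu>0: "\<nu> E = 0" if "E \<notin> \<S>" for E
    using \<phi> that by (auto simp: \<nu>_def intro!: sum.neutral)
  have \<nu>1: "sum \<nu> ?P = 0"
  proof -
    have "sum \<nu> ?P = (\<Sum>b\<in>B - C. \<Sum>E\<in>?P. \<alpha> b * ((if E = D' b then 1 else 0) - (if E = D b then 1 else 0)))"
      unfolding \<nu>_def by (rule sum.swap)
    also have "\<dots> = 0"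
      using DP by (intro sum.neutral) (auto simp: sum_distrib_left[symmetric] sum_subtractf)
    finally show ?thesis .
  qed
  have \<nu>2: "(\<Sum>E\<in>?P. \<nu> E *\<^sub>R charvec E) = v"
  proof -
    have "(\<Sum>E\<in>?P. \<nu> E *\<^sub>R charvec E) = (\<Sum>E\<in>?P. \<Sum>b\<in>B - C.
        \<alpha> b *\<^sub>R ((if E = D' b then charvec E else 0) - (if E = D b then charvec E else 0)))"
      unfolding \<nu>_def scaleR_sum_left by (intro sum.cong) auto
    also have "\<dots> = (\<Sum>b\<in>B - C. \<Sum>E\<in>?P.
        \<alpha> b *\<^sub>R ((if E = D' b then charvec E else 0) - (if E = D b then charvec E else 0)))"
      by (rule sum.swap)
    also have "\<dots> = (\<Sum>b\<in>B - C. \<alpha> b *\<^sub>R (charvec (D' b) - charvec (D b)))"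
      using DP by (intro sum.cong) (simp_all add: scaleR_right.sum[symmetric] sum_subtractf)
    also have "\<dots> = v" using \<phi> by (simp add: v_def d_def)
    finally show ?thesis .
  qed
  \<comment> \<open>The summand 1 keeps the denominator positive; \<open>T\<close> dominates every
    \<open>\<bar>\<nu> E\<bar>\<close>, so the change of each weight is at most the least positive
    weight.\<close>
  define T where "T = 1 + (\<Sum>E\<in>?P. \<bar>\<nu> E\<bar>)"
  define t where "t = Min (\<mu> ` \<S>) / T"
  have "T \<ge> 1" by (auto simp: T_def intro: sum_nonneg)
  have BS: "B \<in> \<S>" using B by (simp add: \<S>_def)
  have "Min (\<mu> ` \<S>) \<in> \<mu> ` \<S>" using BS by (intro Min_in) auto
  then have Mpos: "Min (\<mu> ` \<S>) > 0" by (auto simp: \<S>_def)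
  then have t: "t > 0" using \<open>T \<ge> 1\<close> by (simp add: t_def)
  have small: "t * \<bar>\<nu> E\<bar> \<le> \<mu> E" if "E \<in> \<S>" for E
  proof -
    have "\<bar>\<nu> E\<bar> \<le> (\<Sum>E\<in>?P. \<bar>\<nu> E\<bar>)" using that by (intro member_le_sum) (auto simp: \<S>_def)
    then have "t * \<bar>\<nu> E\<bar> \<le> t * T" using t by (intro mult_left_mono) (auto simp: T_def)
    also have "\<dots> = Min (\<mu> ` \<S>)" using \<open>T \<ge> 1\<close> by (simp add: t_def)
    also have "\<dots> \<le> \<mu> E" using that by (intro Min_le) auto
    finally show ?thesis .
  qed
  have mem: "xs + r *\<^sub>R v \<in> base_polytope indep" if "\<bar>r\<bar> = t" for r
  proof -
    have "0 \<le> \<mu> E + r * \<nu> E" if "is_basis indep E" for E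
    proof (cases "E \<in> \<S>")
      case True
      have "\<bar>r * \<nu> E\<bar> \<le> \<mu> E" using small[OF True] \<open>\<bar>r\<bar> = t\<close> by (simp add: abs_mult)
      then show ?thesis by linarith
    next
      case False
      then show ?thesis using \<nu>0 \<mu> that by (simp add: basis_weights_def)
    qed
    moreover have "(\<Sum>E\<in>?P. (\<mu> E + r * \<nu> E) *\<^sub>R charvec E) =
        (\<Sum>E\<in>?P. \<mu> E *\<^sub>R charvec E) + r *\<^sub>R (\<Sum>E\<in>?P. \<nu> E *\<^sub>R charvec E)"
      by (simp add: scaleR_add_left sum.distrib scaleR_right.sum)
    ultimately have "basis_weights indep (xs + r *\<^sub>R v) (\<lambda>E. \<mu> E + r * \<nu> E)"
      using \<mu> \<nu>1 \<nu>2 by (simp add: basis_weights_def sum.distrib sum_distrib_left[symmetric])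
    then show ?thesis using base_polytope_weights by blast
  qed
  have "wmult W xs = w" using ext by (auto simp: extreme_point_of_def)
  then have "wmult W (xs + r *\<^sub>R v) = w" for r
    using \<open>wmult W v = 0\<close> by (simp add: linear_add[OF wmult_linear] linear_scale[OF wmult_linear])
  then have mem': "xs + r *\<^sub>R v \<in> base_polytope indep \<inter> {x. wmult W x = w}" if "\<bar>r\<bar> = t" for r
    using mem[OF that] by simp
  have "xs + t *\<^sub>R v \<in> base_polytope indep \<inter> {x. wmult W x = w}"
    using t by (intro mem') simp
  moreover have "xs + (- t) *\<^sub>R v \<in> base_polytope indep \<inter> {x. wmult W x = w}"
    using t by (intro mem') simp
  moreover have "xs \<in> open_segment (xs + t *\<^sub>R v) (xs + (- t) *\<^sub>R v)"
  proof -
    have "xs = (1 - 1/2) *\<^sub>R (xs + t *\<^sub>R v) + (1/2) *\<^sub>R (xs + (- t) *\<^sub>R v)"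
      by (simp add: algebra_simps flip: scaleR_add_left)
    moreover have "xs + t *\<^sub>R v \<noteq> xs + (- t) *\<^sub>R v"
      using t \<open>v \<noteq> 0\<close> by (simp add: eq_neg_iff_add_eq_0 flip: scaleR_add_left)
    ultimately show ?thesis unfolding in_segment by (intro conjI exI[of _ "1/2"]) auto
  qed
  ultimately show False using ext unfolding extreme_point_of_def by blast
qed

text \<open>Any basis \<open>B\<close> of positive weight works: by convexity the distance from
  \<open>xs\<close> to \<open>B\<close> is at most the weighted average of the distances from the
  support bases to \<open>B\<close>, each at most \<open>2 * m\<close>.\<close>

lemma extreme_point_near_basis:
  fixes W :: "int^'n^'m::finite"
  assumes ext: "xs extreme_point_of (base_polytope indep \<inter> {x. wmult W x = w})"
  shows "\<exists>B. is_basis indep B \<and> l1dist xs (charvec B) \<le> 2 * real CARD('m)"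
proof -
  let ?P = "{C. is_basis indep C}"
  have "xs \<in> base_polytope indep" using ext by (auto simp: extreme_point_of_def)
  then obtain \<mu>0 where "basis_weights indep xs \<mu>0" using base_polytope_weights by blast
  from exchange_closed_weights[OF this] obtain \<mu> where \<mu>: "basis_weights indep xs \<mu>"
    and closed: "exchange_closed indep \<mu>"
    by blast
  have \<mu>': "\<And>C. C \<in> ?P \<Longrightarrow> 0 \<le> \<mu> C" "sum \<mu> ?P = 1" "(\<Sum>C\<in>?P. \<mu> C *\<^sub>R charvec C) = xs"
    using \<mu> by (auto simp: basis_weights_def)
  have "\<exists>B\<in>?P. 0 < \<mu> B"
  proof (rule ccontr)
    assume "\<not> ?thesis"
    then have "sum \<mu> ?P \<le> 0" by (intro sum_nonpos) force
    then show False using \<mu>' by simp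
  qed
  then obtain B where B: "is_basis indep B" "0 < \<mu> B" by auto
  note close = extreme_support_close[OF ext \<mu> closed]
  have "l1dist xs (charvec B) \<le> (\<Sum>e\<in>UNIV. \<Sum>C\<in>?P. \<mu> C * \<bar>charvec C $ e - charvec B $ e\<bar>)"
    unfolding l1dist_def
  proof (rule sum_mono)
    fix e
    have "xs $ e = (\<Sum>C\<in>?P. \<mu> C * charvec C $ e)" using arg_cong[OF \<mu>'(3), of "\<lambda>x. x $ e"] by simp
    moreover have "charvec B $ e = (\<Sum>C\<in>?P. \<mu> C * charvec B $ e)"
      using \<mu>'(2) by (simp add: sum_distrib_right[symmetric])
    ultimately have "xs $ e - charvec B $ e = (\<Sum>C\<in>?P. \<mu> C * (charvec C $ e - charvec B $ e))"
      by (simp add: sum_subtractf right_diff_distrib)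
    also have "\<bar>\<dots>\<bar> \<le> (\<Sum>C\<in>?P. \<mu> C * \<bar>charvec C $ e - charvec B $ e\<bar>)"
      by (rule order.trans[OF sum_abs], rule sum_mono) (use \<mu>'(1) in \<open>auto simp: abs_mult\<close>)
    finally show "\<bar>xs $ e - charvec B $ e\<bar> \<le> (\<Sum>C\<in>?P. \<mu> C * \<bar>charvec C $ e - charvec B $ e\<bar>)" .
  qed
  also have "\<dots> = (\<Sum>C\<in>?P. \<mu> C * l1dist (charvec C) (charvec B))"
    unfolding l1dist_def by (subst sum.swap) (simp add: sum_distrib_left)
  also have "\<dots> \<le> (\<Sum>C\<in>?P. \<mu> C * (2 * real CARD('m)))"
  proof (rule sum_mono)
    fix C assume C: "C \<in> ?P"
    show "\<mu> C * l1dist (charvec C) (charvec B) \<le> \<mu> C * (2 * real CARD('m))"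
    proof (cases "0 < \<mu> C")
      case True
      then have "card (B - C) \<le> CARD('m)" "card (C - B) \<le> CARD('m)" using B C close by auto
      then have "l1dist (charvec C) (charvec B) \<le> 2 * real CARD('m)" by (simp add: l1dist_charvec)
      then show ?thesis using True by simp
    next
      case False
      then show ?thesis using \<mu>'(1)[OF C] by simp
    qed
  qed
  also have "\<dots> = 2 * real CARD('m)" using \<mu>'(2) by (simp add: sum_distrib_right[symmetric])
  finally show ?thesis using B by blast
qed

end

section \<open>Proximity\<close>

context finite_matroid
begin

text \<open>\<open>N\<close> bounds the length of a zero-sum block of pairs and serves as the robustness threshold;
  \<open>h\<close> bounds the number of elements of \<open>A - B\<close> that are not in a robust pair.\<close>
lemma closer_basis:
  fixes W :: "int^'n^'m::finite" and \<Delta> K N h :: nat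
  assumes A: "is_basis indep A" and B: "is_basis indep B"
    and W: "\<forall>i e. \<bar>W $ i $ e\<bar> \<le> int \<Delta>"
    and K: "\<forall>i. \<bar>wset W B $ i - wset W A $ i\<bar> \<le> int K"
    and N: "N = (2 * CARD('m) * (2 * \<Delta>) + 2) ^ CARD('m)"
    and h: "h = ((2 * \<Delta> + 1) ^ CARD('m)) ^ 2 * N"
    and large: "h + N * (K + 2 * \<Delta> * h) \<le> card (A - B)" "h + (N + CARD('m)) \<le> card (A - B)"
  shows "\<exists>A'. is_basis indep A' \<and> wset W A' = wset W A \<and> card (A' - B) < card (A - B)"
proof -
  define col where "col e = column e W" for e
  \<comment> \<open>Recording membership in \<open>B\<close> besides the weight ensures that
    replacing an element within its class changes neither the total weight nor the distance to
    \<open>B\<close>.\<close>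
  define \<kappa> where "\<kappa> e = (e \<in> B, col e)" for e
  define \<tau> where "\<tau> = (2 * \<Delta> + 1) ^ CARD('m)"
  have wset: "wset W S = (\<Sum>e\<in>S. col e)" for S
    by (simp add: wset_def col_def column_def vec_eq_iff)
  have cb: "\<bar>col e $ i\<bar> \<le> int \<Delta>" for e i using W by (simp add: col_def column_def)
  have "card (col ` S) \<le> \<tau>" for S
  proof -
    let ?T = "{v::int^'m. \<forall>i. v $ i \<in> {- int \<Delta>..int \<Delta>}}"
    have "col ` S \<subseteq> ?T" using cb by (auto simp: abs_le_iff minus_le_iff)
    then have "card (col ` S) \<le> card ?T" by (intro card_mono card_vec_box) auto
    also have "card ?T = (\<Prod>i\<in>(UNIV::'m set). card {- int \<Delta>..int \<Delta>})"
      by (rule card_vec_box) simp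
    also have "\<dots> = \<tau>" by (simp add: \<tau>_def nat_add_distrib nat_mult_distrib)
    finally show ?thesis .
  qed
  note types = this
  \<comment> \<open>On \<open>A - B\<close> and on \<open>B - A\<close> the membership bit is
    constant, so only the weight vectors count.\<close>
  have "card (\<kappa> ` S) \<le> \<tau>" if "S \<subseteq> B \<or> S \<inter> B = {}" for S
  proof -
    have "\<kappa> ` S = Pair (S \<subseteq> B) ` (col ` S)" using that by (auto simp: \<kappa>_def image_iff)
    then have "card (\<kappa> ` S) \<le> card (col ` S)" by (simp add: card_image_le)
    then show ?thesis using types order.trans by blast
  qed
  then have \<tau>: "card (\<kappa> ` (A - B)) \<le> \<tau>" "card (\<kappa> ` (B - A)) \<le> \<tau>" by auto
  from many_robust_pairs[OF A B \<tau>, of N] obtain Q \<beta> where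
    Q: "Q \<subseteq> A - B" "inj_on \<beta> Q" "\<beta> ` Q \<subseteq> B - A" "\<forall>a\<in>Q. robust_pair \<kappa> A N a (\<beta> a)"
    and cQ: "card (A - B) \<le> card Q + h"
    by (auto simp: h \<tau>_def power2_eq_square)
  define g where "g a = col (\<beta> a) - col a" for a
  have gb: "\<bar>g a $ i\<bar> \<le> int (2 * \<Delta>)" for a i
    using cb[of "\<beta> a" i] cb[of a i] by (simp add: g_def)
  have cAB: "card (B - A) = card (A - B)"
    using A B card_Int_Diff[of A B] card_Int_Diff[of B A] by (simp add: is_basis_iff Int_commute)
  \<comment> \<open>Over all of \<open>A - B\<close> and \<open>B - A\<close> the weights differ by
    \<open>W(B) - W(A)\<close>, bounded by \<open>K\<close>. At most \<open>h\<close> elements on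
    each side are unmatched, and each changes a coordinate by at most \<Delta>.\<close>
  have sumQ: "\<bar>sum g Q $ i\<bar> \<le> int (K + 2 * \<Delta> * h)" for i
  proof -
    have cs: "\<bar>(\<Sum>e\<in>S. col e) $ i\<bar> \<le> int (\<Delta> * h)" if "card S \<le> h" for S
    proof -
      have "\<bar>(\<Sum>e\<in>S. col e) $ i\<bar> \<le> (\<Sum>e\<in>S. int \<Delta>)"
        unfolding sum_component by (rule order.trans[OF sum_abs], rule sum_mono) (rule cb)
      also have "\<dots> = int (\<Delta> * card S)" by simp
      also have "\<dots> \<le> int (\<Delta> * h)" using that by (simp only: of_nat_le_iff mult_le_mono2)
      finally show ?thesis .
    qed
    have "card (A - B - Q) \<le> h" using cQ Q(1) by (simp add: card_Diff_subset finite_subset)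
    moreover have "card (B - A - \<beta> ` Q) \<le> h"
      using cQ Q(2,3) cAB by (simp add: card_Diff_subset finite_subset card_image)
    moreover have "sum g Q = (\<Sum>e\<in>\<beta> ` Q. col e) - (\<Sum>e\<in>Q. col e)"
      using Q(2) by (simp add: g_def sum_subtractf sum.reindex)
    moreover have "(\<Sum>e\<in>\<beta> ` Q. col e) = (\<Sum>e\<in>B - A. col e) - (\<Sum>e\<in>B - A - \<beta> ` Q. col e)"
      using Q(3) by (simp add: sum_diff)
    moreover have "(\<Sum>e\<in>Q. col e) = (\<Sum>e\<in>A - B. col e) - (\<Sum>e\<in>A - B - Q. col e)"
      using Q(1) by (simp add: sum_diff)
    moreover have "wset W B = (\<Sum>e\<in>B - A. col e) + (\<Sum>e\<in>A \<inter> B. col e)"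
      unfolding wset by (subst sum.union_disjoint[symmetric]) (auto intro!: sum.cong)
    moreover have "wset W A = (\<Sum>e\<in>A - B. col e) + (\<Sum>e\<in>A \<inter> B. col e)"
      unfolding wset by (subst sum.union_disjoint[symmetric]) (auto intro!: sum.cong)
    ultimately have "sum g Q = wset W B - wset W A
        - (\<Sum>e\<in>B - A - \<beta> ` Q. col e) + (\<Sum>e\<in>A - B - Q. col e)"
      "\<bar>(\<Sum>e\<in>B - A - \<beta> ` Q. col e) $ i\<bar> \<le> int (\<Delta> * h)" "\<bar>(\<Sum>e\<in>A - B - Q. col e) $ i\<bar> \<le> int (\<Delta> * h)"
      using cs by simp_all
    then show ?thesis using K[rule_format, of i] by simp
  qed
  have "N * (K + 2 * \<Delta> * h) \<le> card Q" "N + CARD('m) \<le> card Q" using large cQ by linarith+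
  then obtain Z where Z: "Z \<subseteq> Q" "Z \<noteq> {}" "card Z \<le> N" "sum g Z = 0"
    using zero_sum_subset[of Q g "2 * \<Delta>" "K + 2 * \<Delta> * h" N] gb sumQ N by auto
  define J where "J = (A - Z) \<union> \<beta> ` Z"
  have inj: "inj_on \<beta> Z" using Q(2) Z(1) inj_on_subset by blast
  have disj: "\<beta> ` Z \<inter> A = {}" and ZA: "Z \<subseteq> A" using Q(1,3) Z(1) by blast+
  have "robust_pair \<kappa> A N a (\<beta> a)" if "a \<in> Z" for a using Q(4) Z(1) that by blast
  then have "\<exists>x A'. is_basis indep A' \<and> bij_betw x J A' \<and> (\<forall>e\<in>J. \<kappa> (x e) = \<kappa> e)"
    unfolding J_def by (rule exchange_robust_pairs[OF A ZA Z(3) inj disj])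
  then obtain x A' where
    A': "is_basis indep A'" and x: "bij_betw x J A'" and \<kappa>x: "\<forall>e\<in>J. \<kappa> (x e) = \<kappa> e"
    by blast
  have "wset W A' = (\<Sum>e\<in>J. col (x e))"
    unfolding wset using x by (rule sum.reindex_bij_betw[symmetric])
  also have "\<dots> = (\<Sum>e\<in>J. col e)" using \<kappa>x by (intro sum.cong) (auto simp: \<kappa>_def)
  also have "\<dots> = (\<Sum>e\<in>A - Z. col e) + (\<Sum>a\<in>Z. col (\<beta> a))"
    unfolding J_def using disj inj by (subst sum.union_disjoint) (auto simp: sum.reindex)
  also have "\<dots> = (\<Sum>e\<in>A. col e) + sum g Z"
    using ZA by (simp add: sum_diff g_def sum_subtractf)
  also have "\<dots> = wset W A" by (simp add: Z wset)
  finally have "wset W A' = wset W A" .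
  moreover have "A' - B = x ` (A - B - Z)"
  proof -
    have "A' = x ` J" using x by (simp add: bij_betw_def)
    moreover have "x e \<in> B \<longleftrightarrow> e \<in> B" if "e \<in> J" for e using \<kappa>x that by (simp add: \<kappa>_def)
    ultimately have "A' - B = x ` (J - B)" by auto
    moreover have "J - B = A - B - Z" using Q(3) Z(1) by (auto simp: J_def)
    ultimately show ?thesis by simp
  qed
  then have "card (A' - B) \<le> card (A - B - Z)" by (simp add: card_image_le)
  moreover have "card (A - B - Z) < card (A - B)"
    using Z(1,2) Q(1) by (intro psubset_card_mono) auto
  ultimately show ?thesis using A' by auto
qed

end

text \<open>With \<open>N \<le> x ^ (3 * m)\<close> and \<open>h \<le> x ^ (7 * m)\<close>, the
  dominant term \<open>N * (2 * \<Delta> * h)\<close> is at most \<open>x ^ (11 * m)\<close>. The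
  other terms are at most \<open>x ^ (8 * m)\<close>, and the numerical factors are absorbed using
  \<open>x \<ge> 2\<close>.\<close>

lemma proximity_bound:
  fixes m \<Delta> N h x :: nat
  assumes "m > 0" "\<Delta> > 0" and x: "x = 2 * m * \<Delta>"
    and N: "N = (2 * m * (2 * \<Delta>) + 2) ^ m" and h: "h = ((2 * \<Delta> + 1) ^ m) ^ 2 * N"
  shows "x + 2 * (h + N * (x + 2 * \<Delta> * h)) \<le> x ^ (13 * m)"
proof -
  have x2: "x \<ge> 2" using assms by (simp add: Suc_le_eq)
  have Dx: "2 * \<Delta> \<le> x" using assms by simp
  have p: "x ^ i \<le> x ^ j" if "i \<le> j" for i j using that x2 by (intro power_increasing) auto
  have sq: "2 * x \<le> x ^ 2" using x2 by (simp add: power2_eq_square)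
  have "2 * m * (2 * \<Delta>) + 2 \<le> 3 * x" using x x2 by simp
  also have "\<dots> \<le> x ^ 3"
  proof -
    have "3 \<le> x * x" using mult_le_mono[OF x2 x2] by linarith
    then have "3 * x \<le> x * x * x" by (rule mult_le_mono1)
    then show ?thesis by (simp add: power3_eq_cube)
  qed
  finally have "N \<le> (x ^ 3) ^ m" unfolding N by (intro power_mono) auto
  then have Nx: "N \<le> x ^ (3 * m)" by (simp add: power_mult)
  have "2 * \<Delta> + 1 \<le> x ^ 2" using Dx sq x2 by linarith
  then have "(2 * \<Delta> + 1) ^ m \<le> (x ^ 2) ^ m" by (rule power_mono) simp
  then have "((2 * \<Delta> + 1) ^ m) ^ 2 \<le> ((x ^ 2) ^ m) ^ 2" by (rule power_mono) simp
  also have "\<dots> = x ^ (4 * m)" by (simp flip: power_mult add: mult.commute)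
  finally have "h \<le> x ^ (4 * m) * x ^ (3 * m)" unfolding h using Nx by (intro mult_mono) auto
  then have hx: "h \<le> x ^ (7 * m)" by (simp flip: power_add)
  have "N * x \<le> x ^ (3 * m) * x" using Nx by simp
  also have "\<dots> = x ^ (3 * m + 1)" by simp
  also have "\<dots> \<le> x ^ (8 * m)" using assms(1) by (intro p) simp
  finally have a: "N * x \<le> x ^ (8 * m)" .
  have "N * (2 * \<Delta> * h) \<le> x ^ (3 * m) * (x * x ^ (7 * m))" using Nx Dx hx by (intro mult_mono) auto
  also have "\<dots> = x ^ (3 * m + 1 + 7 * m)" by (simp only: power_add power_one_right mult_ac)
  also have "\<dots> \<le> x ^ (11 * m)" using assms(1) by (intro p) simp
  finally have b: "N * (2 * \<Delta> * h) \<le> x ^ (11 * m)" .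
  have c: "h \<le> x ^ (8 * m)" using hx p[of "7 * m" "8 * m"] by simp
  have d: "x \<le> x ^ (8 * m)" using p[of 1 "8 * m"] assms(1) by simp
  have e: "8 * x ^ (8 * m) \<le> x ^ (11 * m)"
  proof -
    have "8 \<le> x ^ 3" using power_mono[OF x2, of 3] by simp
    also have "\<dots> \<le> x ^ (3 * m)" using assms(1) by (intro p) simp
    finally have "8 * x ^ (8 * m) \<le> x ^ (3 * m) * x ^ (8 * m)" by simp
    then show ?thesis by (simp flip: power_add)
  qed
  have f: "4 * x ^ (11 * m) \<le> x ^ (13 * m)"
  proof -
    have "4 \<le> x ^ 2" using power_mono[OF x2, of 2] by simp
    also have "\<dots> \<le> x ^ (2 * m)" using assms(1) by (intro p) simp
    finally have "4 * x ^ (11 * m) \<le> x ^ (2 * m) * x ^ (11 * m)" by simp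
    then show ?thesis by (simp flip: power_add)
  qed
  have "x + 2 * (h + N * (x + 2 * \<Delta> * h)) = x + 2 * h + 2 * (N * x) + 2 * (N * (2 * \<Delta> * h))"
    by (simp add: algebra_simps)
  also have "\<dots> \<le> x ^ (13 * m)" using a b c d e f by linarith
  finally show ?thesis .
qed

theorem theorem2:
  fixes indep :: "'n::finite set \<Rightarrow> bool"
    and W :: "int^'n^'m::finite"
    and \<Delta> :: nat
    and A :: "'n set"
    and xs :: "real^'n"
  assumes "matroid indep"
    and "\<Delta> > 0"
    and "\<forall>i e. \<bar>W $ i $ e\<bar> \<le> int \<Delta>"
    and "is_basis indep A"
    and "xs extreme_point_of
           (base_polytope indep \<inter> {x. wmult W x = wmult W (charvec A)})"
  shows "\<exists>A'. is_basis indep A' \<and> wset W A' = wset W A \<and>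
           l1dist xs (charvec A') \<le> (2 * real CARD('m) * real \<Delta>) ^ (13 * CARD('m))"
proof -
  interpret finite_matroid indep by unfold_locales (rule assms(1))
  \<comment> \<open>\<open>K\<close> bounds each coordinate of \<open>W(B) - W(A)\<close>: entries
    of size at most \<Delta> meet an l1 distance of at most \<open>2 * m\<close> between
    \<open>xs\<close> and \<open>B\<close>, and \<open>xs\<close> has the same weight as
    \<open>A\<close>. It is also the base of the final power.\<close>
  define K where "K = 2 * CARD('m) * \<Delta>"
  define N where "N = (2 * CARD('m) * (2 * \<Delta>) + 2) ^ CARD('m)"
  define h where "h = ((2 * \<Delta> + 1) ^ CARD('m)) ^ 2 * N"
  obtain B where B: "is_basis indep B" "l1dist xs (charvec B) \<le> 2 * real CARD('m)"
    using extreme_point_near_basis[OF assms(5)] by blast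
  obtain A' where A': "is_basis indep A'" "wset W A' = wset W A"
    and min: "\<And>C. is_basis indep C \<Longrightarrow> wset W C = wset W A \<Longrightarrow> card (A' - B) \<le> card (C - B)"
    using ex_has_least_nat[of "\<lambda>C. is_basis indep C \<and> wset W C = wset W A" A "\<lambda>C. card (C - B)"]
      assms(4) by blast
  have wc: "wmult W (charvec S) $ i = real_of_int (wset W S $ i)" for S i
  proof -
    have "wmult W (charvec S) $ i = (\<Sum>e\<in>UNIV. if e \<in> S then real_of_int (W $ i $ e) else 0)"
      by (auto simp: wmult_def charvec_def intro!: sum.cong)
    then show ?thesis by (simp add: sum.If_cases wset_def)
  qed
  have K: "\<bar>wset W B $ i - wset W A' $ i\<bar> \<le> int K" for i
  proof -
    have "wmult W xs = wmult W (charvec A)" using assms(5) by (auto simp: extreme_point_of_def)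
    then have "real_of_int (wset W B $ i - wset W A' $ i) = wmult W (charvec B) $ i - wmult W xs $ i"
      using A'(2) wc by simp
    also have "\<dots> = (\<Sum>e\<in>UNIV. real_of_int (W $ i $ e) * (charvec B $ e - xs $ e))"
      by (simp add: wmult_def sum_subtractf right_diff_distrib)
    finally have "\<bar>real_of_int (wset W B $ i - wset W A' $ i)\<bar> = \<bar>\<dots>\<bar>" by simp
    also have "\<dots> \<le> (\<Sum>e\<in>UNIV. real \<Delta> * \<bar>xs $ e - charvec B $ e\<bar>)"
    proof (rule order.trans[OF sum_abs], rule sum_mono)
      fix e
      have "\<bar>real_of_int (W $ i $ e)\<bar> \<le> real \<Delta>"
        using assms(3) by (metis of_int_abs of_int_le_iff of_int_of_nat_eq)
      then show "\<bar>real_of_int (W $ i $ e) * (charvec B $ e - xs $ e)\<bar> \<le> real \<Delta> * \<bar>xs $ e - charvec B $ e\<bar>"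
        by (simp add: abs_mult abs_minus_commute mult_right_mono)
    qed
    also have "\<dots> = real \<Delta> * l1dist xs (charvec B)" by (simp add: l1dist_def sum_distrib_left)
    also have "\<dots> \<le> real \<Delta> * (2 * real CARD('m))" using B by (intro mult_left_mono) auto
    also have "\<dots> = real K" by (simp add: K_def)
    finally have "real_of_int \<bar>wset W B $ i - wset W A' $ i\<bar> \<le> real_of_int (int K)" by simp
    then show ?thesis by (simp only: of_int_le_iff)
  qed
  have small: "card (A' - B) \<le> h + N * (K + 2 * \<Delta> * h)"
  proof (rule ccontr)
    assume neg: "\<not> ?thesis"
    \<comment> \<open>The second size condition of \<open>closer_basis\<close> follows from the
      first, because \<open>K \<ge> 2 * m \<ge> m + 1\<close> and \<open>N \<ge> 1\<close>.\<close>
    have "N + CARD('m) \<le> N * K"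
    proof -
      have N1: "1 \<le> N" by (simp add: N_def)
      have "CARD('m) + 1 \<le> K"
      proof -
        have "2 * CARD('m) \<le> K" using assms(2) by (simp add: K_def)
        moreover have "1 \<le> CARD('m)" by (simp add: Suc_le_eq)
        ultimately show ?thesis by linarith
      qed
      then have "N * (CARD('m) + 1) \<le> N * K" by (rule mult_le_mono2)
      moreover have "CARD('m) \<le> N * CARD('m)" using N1 by simp
      moreover have "N * (CARD('m) + 1) = N + N * CARD('m)" by simp
      ultimately show ?thesis by linarith
    qed
    then have "h + (N + CARD('m)) \<le> card (A' - B)" using neg by (simp add: distrib_left)
    then obtain C where "is_basis indep C" "wset W C = wset W A'" "card (C - B) < card (A' - B)"
      using closer_basis[OF A'(1) B(1) assms(3) _ N_def h_def, of K] K neg by auto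
    then show False using min[of C] A'(2) by simp
  qed
  have "card (B - A') = card (A' - B)"
    using A'(1) B(1) card_Int_Diff[of A' B] card_Int_Diff[of B A']
    by (simp add: is_basis_iff Int_commute)
  then have "l1dist (charvec B) (charvec A') = real (2 * card (A' - B))" by (simp add: l1dist_charvec)
  moreover have "l1dist xs (charvec A') \<le> l1dist xs (charvec B) + l1dist (charvec B) (charvec A')"
    unfolding l1dist_def sum.distrib[symmetric] by (intro sum_mono) linarith
  moreover have "2 * real CARD('m) \<le> real K"
  proof -
    have "2 * CARD('m) \<le> K" using assms(2) by (simp add: K_def)
    then show ?thesis by (metis of_nat_le_iff of_nat_mult of_nat_numeral)
  qed
  ultimately have "l1dist xs (charvec A') \<le> real (K + 2 * card (A' - B))"
    using B(2) by simp
  also have "\<dots> \<le> real (K + 2 * (h + N * (K + 2 * \<Delta> * h)))"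
    using small by (simp only: of_nat_le_iff add_le_cancel_left) simp
  also have "\<dots> \<le> real (K ^ (13 * CARD('m)))"
    by (simp only: of_nat_le_iff, rule proximity_bound[OF _ assms(2) K_def N_def h_def]) simp
  also have "\<dots> = (2 * real CARD('m) * real \<Delta>) ^ (13 * CARD('m))" by (simp add: K_def)
  finally show ?thesis using A' by blast
qed

end
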